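(* Let $\mathcal{G}=(V,V_d,E)$ be a damping graph such that $(V,E)$ is a tree. Then $\mathcal{G}$ satisfies the zero forcing property if and only if $\mathcal{G}$ is PI-GAS.
   Context: Damping graph. A damping graph $\mathcal{G}=(V,V_d,E)$ is a finite simple connected undirected graph $(V,E)$ together with a nonempty set $V_d\subseteq V$ of damped nodes; $n=|V|$, $m=|E|$. PI-GAS. Fix an integer $r\ge1$, let $B\in\mathbb{R}^{n\times m}$ be an oriented incidence matrix of $(V,E)$ (each column has one $1$ and one $-1$, at the endpoints of the edge) and $\mathbb{B}=B\otimes I_r$. Feasible parameters are block diagonal matrices with $r\times r$ blocks $M=\mathrm{diag}(M_1,\dots,M_n)$, $W=\mathrm{diag}(W_1,\dots,W_m)$, $R=\mathrm{diag}(R_1,\dots,R_n)$, where all $M_i$ and $W_k$ are diagonal and positive definite, $R_i$ is symmetric positive definite for $i\in V_d$, and $R_i$ is symmetric positive semidefinite and singular (possibly zero) for $i\notin V_d$. Consider the linear system $$\dot p=-RM^{-1}p-\mathbb{B}Wq,\qquad \dot q=\mathbb{B}^TM^{-1}p$$ on the invariant subspace $\Omega=\{(p,q)\in\mathbb{R}^{rn}\times\mathbb{R}^{rm}: q\in\operatorname{im}(\mathbb{B}^T)\}$. $\mathcal{G}$ is parameter-independent globally asymptotically stable (PI-GAS) if for all feasible parameters $M,W,R$ the origin of this system on $\Omega$ is globally asymptotically stable. Zero forcing. Start with the damped nodes black and all other nodes white. Repeatedly apply the rule: if a black node has exactly one white neighbor $w$, recolor $w$ black; stop when the rule no longer applies.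 $\mathcal{D}(\mathcal{G})$ denotes the final set of black nodes. $\mathcal{G}$ satisfies the zero forcing property if $\mathcal{D}(\mathcal{G})=V$. *)

theory Defs
  imports Complex_Main "Jordan_Normal_Form.Gauss_Jordan_Elimination"
begin

section \<open>Damping graphs\<close>

text \<open>A finite simple undirected graph has a vertex set \<open>V\<close> and a set \<open>E\<close> of two-element
  subsets of \<open>V\<close>.\<close>

definition simple_graph :: "'a set \<Rightarrow> 'a set set \<Rightarrow> bool" where
  "simple_graph V E \<longleftrightarrow> finite V \<and> (\<forall>e\<in>E. e \<subseteq> V \<and> card e = 2)"

definition connected_graph :: "'a set \<Rightarrow> 'a set set \<Rightarrow> bool" where
  "connected_graph V E \<longleftrightarrow> V \<noteq> {} \<and> (\<forall>u\<in>V. \<forall>v\<in>V. (\<lambda>x y. {x, y} \<in> E)\<^sup>*\<^sup>* u v)"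

definition is_cycle :: "'a set set \<Rightarrow> 'a list \<Rightarrow> bool" where
  "is_cycle E xs \<longleftrightarrow> distinct xs \<and> length xs \<ge> 3 \<and>
     (\<forall>i. Suc i < length xs \<longrightarrow> {xs ! i, xs ! Suc i} \<in> E) \<and> {last xs, hd xs} \<in> E"

definition tree_graph :: "'a set \<Rightarrow> 'a set set \<Rightarrow> bool" where
  "tree_graph V E \<longleftrightarrow> simple_graph V E \<and> connected_graph V E \<and> (\<nexists>xs. is_cycle E xs)"

definition damping_graph :: "'a set \<Rightarrow> 'a set \<Rightarrow> 'a set set \<Rightarrow> bool" where
  "damping_graph V Vd E \<longleftrightarrow>
     simple_graph V E \<and> connected_graph V E \<and> Vd \<noteq> {} \<and> Vd \<subseteq> V"

section \<open>Zero forcing\<close>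

text \<open>\<open>S\<close> is the current set of black nodes.\<close>

inductive zf_step :: "'a set \<Rightarrow> 'a set set \<Rightarrow> 'a set \<Rightarrow> 'a set \<Rightarrow> bool" for V E where
  "b \<in> S \<Longrightarrow> {u \<in> V - S. {b, u} \<in> E} = {w} \<Longrightarrow> zf_step V E S (insert w S)"

definition zf_final :: "'a set \<Rightarrow> 'a set \<Rightarrow> 'a set set \<Rightarrow> 'a set \<Rightarrow> bool" where
  "zf_final V Vd E D \<longleftrightarrow> (zf_step V E)\<^sup>*\<^sup>* Vd D \<and> (\<nexists>D'. zf_step V E D D')"

definition zf_set :: "'a set \<Rightarrow> 'a set \<Rightarrow> 'a set set \<Rightarrow> 'a set" where
  "zf_set V Vd E = (THE D. zf_final V Vd E D)"

definition zero_forcing :: "'a set \<Rightarrow> 'a set \<Rightarrow> 'a set set \<Rightarrow> bool" where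
  "zero_forcing V Vd E \<longleftrightarrow> zf_set V Vd E = V"

text \<open>The description in \<^const>\<open>zf_set\<close> is proper: the order of the recolorings does not matter.\<close>

lemma zf_steps_mono: "(zf_step V E)\<^sup>*\<^sup>* S T \<Longrightarrow> S \<subseteq> T"
  by (induction rule: rtranclp_induct) (auto elim: zf_step.cases)

lemma zf_steps_subset: "(zf_step V E)\<^sup>*\<^sup>* S T \<Longrightarrow> S \<subseteq> V \<Longrightarrow> T \<subseteq> V"
  by (induction rule: rtranclp_induct) (auto elim!: zf_step.cases)

lemma zf_steps_le_stuck:
  assumes "(zf_step V E)\<^sup>*\<^sup>* S T" "S \<subseteq> D" "\<nexists>D'. zf_step V E D D'"
  shows "T \<subseteq> D"
  using assms(1,2)
proof (induction rule: rtranclp_induct)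
  case (step T T')
  from step.hyps(2) obtain b w where bw: "b \<in> T" "{u \<in> V - T. {b, u} \<in> E} = {w}" "T' = insert w T"
    by (auto elim: zf_step.cases)
  have TD: "T \<subseteq> D" using step by blast
  have "w \<in> D"
  proof (rule ccontr)
    assume "w \<notin> D"
    with bw(2) TD have "{u \<in> V - D. {b, u} \<in> E} = {w}" by blast
    with bw(1) TD have "zf_step V E D (insert w D)" by (intro zf_step.intros) auto
    with assms(3) show False by blast
  qed
  with bw(3) TD show ?case by blast
qed

lemma zf_final_ex1:
  assumes "finite V" "Vd \<subseteq> V"
  shows "\<exists>!D. zf_final V Vd E D"
proof (rule ex_ex1I)
  show "\<exists>D. zf_final V Vd E D"
    using assms(2)
  proof (induction "card (V - Vd)" arbitrary: Vd rule: less_induct)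
    case less
    show ?case
    proof (cases "\<exists>D'. zf_step V E Vd D'")
      case True
      then obtain D' where D': "zf_step V E Vd D'" by blast
      then obtain b w where "{u \<in> V - Vd. {b, u} \<in> E} = {w}" "D' = insert w Vd"
        by (auto elim: zf_step.cases)
      with D' have w: "zf_step V E Vd (insert w Vd)" "w \<in> V - Vd"
        by blast+
      have "card (V - insert w Vd) < card (V - Vd)"
        using w(2) assms(1) by (intro psubset_card_mono) auto
      then obtain D where "zf_final V (insert w Vd) E D"
        using less w(2) by blast
      with w(1) have "zf_final V Vd E D"
        unfolding zf_final_def by (meson converse_rtranclp_into_rtranclp)
      then show ?thesis by blast
    next
      case False
      then show ?thesis unfolding zf_final_def by blast
    qed
  qed
next
  fix D D' assume "zf_final V Vd E D" "zf_final V Vd E D'"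
  then show "D = D'"
    unfolding zf_final_def by (meson zf_steps_le_stuck zf_steps_mono subset_antisym)
qed

section \<open>Matrices\<close>

text \<open>The matrix library has neither a Kronecker product nor definiteness.\<close>

definition kronecker :: "real mat \<Rightarrow> real mat \<Rightarrow> real mat" where
  "kronecker A C = mat (dim_row A * dim_row C) (dim_col A * dim_col C)
     (\<lambda>(i, j). A $$ (i div dim_row C, j div dim_col C) * C $$ (i mod dim_row C, j mod dim_col C))"

definition pos_def :: "nat \<Rightarrow> real mat \<Rightarrow> bool" where
  "pos_def r A \<longleftrightarrow> A \<in> carrier_mat r r \<and> transpose_mat A = A \<and>
     (\<forall>x\<in>carrier_vec r. x \<noteq> 0\<^sub>v r \<longrightarrow> x \<bullet> (A *\<^sub>v x) > 0)"

definition pos_semidef :: "nat \<Rightarrow> real mat \<Rightarrow> bool" where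
  "pos_semidef r A \<longleftrightarrow> A \<in> carrier_mat r r \<and> transpose_mat A = A \<and>
     (\<forall>x\<in>carrier_vec r. x \<bullet> (A *\<^sub>v x) \<ge> 0)"

text \<open>Only used for invertible matrices.\<close>

abbreviation minv :: "real mat \<Rightarrow> real mat" where
  "minv A \<equiv> the (mat_inverse A)"

text \<open>The lists \<open>vs\<close> and \<open>es\<close> number the nodes and the edges, so that \<open>n = length vs\<close> and
  \<open>m = length es\<close>; \<open>m = 0\<close> is possible.\<close>

definition numbering :: "'a list \<Rightarrow> 'a set \<Rightarrow> bool" where
  "numbering xs A \<longleftrightarrow> distinct xs \<and> set xs = A"

definition oriented_incidence :: "'a list \<Rightarrow> 'a set list \<Rightarrow> real mat \<Rightarrow> bool" where
  "oriented_incidence vs es B \<longleftrightarrow> B \<in> carrier_mat (length vs) (length es) \<and>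
     (\<forall>k<length es. \<exists>i<length vs. \<exists>j<length vs. i \<noteq> j \<and> es ! k = {vs ! i, vs ! j} \<and>
        B $$ (i, k) = 1 \<and> B $$ (j, k) = -1 \<and>
        (\<forall>l<length vs. l \<noteq> i \<and> l \<noteq> j \<longrightarrow> B $$ (l, k) = 0))"

definition feasible ::
    "nat \<Rightarrow> 'a list \<Rightarrow> 'a set list \<Rightarrow> 'a set \<Rightarrow> real mat \<Rightarrow> real mat \<Rightarrow> real mat \<Rightarrow> bool" where
  "feasible r vs es Vd M W R \<longleftrightarrow> (\<exists>Ms Ws Rs.
     length Ms = length vs \<and> length Ws = length es \<and> length Rs = length vs \<and>
     M = diag_block_mat Ms \<and> W = diag_block_mat Ws \<and> R = diag_block_mat Rs \<and>
     (\<forall>i<length vs. diagonal_mat (Ms ! i) \<and> pos_def r (Ms ! i)) \<and>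
     (\<forall>k<length es. diagonal_mat (Ws ! k) \<and> pos_def r (Ws ! k)) \<and>
     (\<forall>i<length vs. vs ! i \<in> Vd \<longrightarrow> pos_def r (Rs ! i)) \<and>
     (\<forall>i<length vs. vs ! i \<notin> Vd \<longrightarrow> pos_semidef r (Rs ! i) \<and> \<not> invertible_mat (Rs ! i)))"

section \<open>The linear system\<close>

text \<open>Derivatives of vector-valued functions on \<open>[0, \<infinity>)\<close> are taken componentwise, one-sided at
  \<open>0\<close>.\<close>

definition vec_deriv :: "(real \<Rightarrow> real vec) \<Rightarrow> real vec \<Rightarrow> real \<Rightarrow> bool" where
  "vec_deriv x x' t \<longleftrightarrow> (\<forall>i<dim_vec x'.
     ((\<lambda>s. x s $ i) has_real_derivative x' $ i) (at t within {0..}))"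

definition state_norm :: "real vec \<Rightarrow> real vec \<Rightarrow> real" where
  "state_norm p q = sqrt (p \<bullet> p + q \<bullet> q)"

text \<open>In the following, \<open>BB\<close> is the matrix \<open>B \<otimes> I\<^sub>r\<close>.\<close>

definition in_Omega :: "real mat \<Rightarrow> real vec \<Rightarrow> real vec \<Rightarrow> bool" where
  "in_Omega BB p q \<longleftrightarrow> p \<in> carrier_vec (dim_row BB) \<and>
     q \<in> (\<lambda>u. transpose_mat BB *\<^sub>v u) ` carrier_vec (dim_row BB)"

definition solution ::
    "real mat \<Rightarrow> real mat \<Rightarrow> real mat \<Rightarrow> real mat \<Rightarrow> (real \<Rightarrow> real vec) \<Rightarrow> (real \<Rightarrow> real vec) \<Rightarrow> bool" where
  "solution BB M W R p q \<longleftrightarrow> (\<forall>t\<ge>0.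
     p t \<in> carrier_vec (dim_row BB) \<and> q t \<in> carrier_vec (dim_col BB) \<and>
     vec_deriv p (- ((R * minv M) *\<^sub>v p t) - (BB * W) *\<^sub>v q t) t \<and>
     vec_deriv q ((transpose_mat BB * minv M) *\<^sub>v p t) t)"

text \<open>Lyapunov stability of the origin together with convergence to it of every solution starting in
  \<open>\<Omega>\<close>. Since \<open>\<Omega>\<close> is invariant, it suffices to restrict the initial state. The system is
  linear, so all solutions exist on \<open>[0, \<infinity>)\<close>.\<close>

definition origin_GAS :: "real mat \<Rightarrow> real mat \<Rightarrow> real mat \<Rightarrow> real mat \<Rightarrow> bool" where
  "origin_GAS BB M W R \<longleftrightarrow>
     (\<forall>\<epsilon>>0. \<exists>\<delta>>0. \<forall>p q. solution BB M W R p q \<and> in_Omega BB (p 0) (q 0) \<and>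
        state_norm (p 0) (q 0) < \<delta> \<longrightarrow> (\<forall>t\<ge>0. state_norm (p t) (q t) < \<epsilon>)) \<and>
     (\<forall>p q. solution BB M W R p q \<and> in_Omega BB (p 0) (q 0) \<longrightarrow>
        ((\<lambda>t. state_norm (p t) (q t)) \<longlongrightarrow> 0) at_top)"

definition PI_GAS :: "nat \<Rightarrow> 'a list \<Rightarrow> 'a set list \<Rightarrow> 'a set \<Rightarrow> real mat \<Rightarrow> bool" where
  "PI_GAS r vs es Vd B \<longleftrightarrow> (\<forall>M W R. feasible r vs es Vd M W R \<longrightarrow>
     origin_GAS (kronecker B (1\<^sub>m r)) M W R)"

end

(* If G is zero forcing: along a solution the energy p.M^{-1}p/2 + q.Wq/2 decreases at rate v.Rv, where
   v = M^{-1}p, so solutions are bounded, and by Barbalat's lemma (a convergent function with bounded second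
   derivative has derivative tending to 0) Rv tends to 0, hence v tends to 0 at the damped nodes. If v tends
   to 0 at a node then so do p' and therefore the net edge force BWq there, and then its derivative, a
   combination of the velocities of the node and its neighbours; a unique white neighbour is thus forced too.
   Once all velocities and net forces tend to 0, so does q: deleting an edge of a tree splits it, and the net
   forces on one side add up to plus or minus the force in that edge.

   Conversely, suppose that the final black set D is not V. The white nodes get signs that alternate along
   white-white edges and such that every black node with a white neighbour has neighbours of both signs; with
   suitable masses and spring constants this sign vector, extended by 0 to D, is an eigenvector of the
   weighted Laplacian relative to the mass matrix, which gives an undamped oscillation. *)

theory Submission
  imports Defs "Jordan_Normal_Form.Determinant"
begin

section \<open>Signs on trees\<close>

text \<open>The obstacle in the direct part is an undamped node whose block \<open>R_i\<close> is
  singular but not zero: its friction neither drives the velocity to 0 nor drops out of the equation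
  of motion. Semidefiniteness helps: vanishing dissipation makes \<open>R v\<close> small at every
  node, so friction can be discarded from the limit of the equation of motion even there. Barbalat's
  lemma is applied to one given solution, and second derivatives are never written out: all
  functions involved are polynomials in the bounded states, hence again bounded with bounded
  derivative. The \<open>r\<close> components of a node interact only through \<open>R_i\<close>, so
  forcing runs in each component separately. In the converse, the signs exist because on a forest
  every prescription of sign products along the edges is realized by a sign function. The weights
  are then found in two independent steps: edges between black and white nodes balance each black
  node, and the mass of a white node is read off from the eigenvector equation. The eigenvalue is
  normalized to 1, so the oscillation has period \<open>2 * pi\<close>.\<close>

lemma rtranclp_distinct_path:
  assumes "(\<lambda>x y. {x, y} \<in> F)\<^sup>*\<^sup>* a b"
  shows "\<exists>xs. xs \<noteq> [] \<and> distinct xs \<and> hd xs = a \<and> last xs = b \<and> successively (\<lambda>x y. {x, y} \<in> F) xs"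
  using assms
proof (induction rule: converse_rtranclp_induct)
  case base
  show ?case by (rule exI[of _ "[b]"]) simp
next
  case (step a c)
  then obtain xs where xs: "xs \<noteq> []" "distinct xs" "hd xs = c" "last xs = b"
    "successively (\<lambda>x y. {x, y} \<in> F) xs" by blast
  show ?case
  proof (cases "a \<in> set xs")
    \<comment> \<open>When \<open>a\<close> already lies on the path, the path is cut to start at
      that occurrence, which keeps its vertices distinct.\<close>
    case True
    then obtain ys zs where "xs = ys @ a # zs" by (meson split_list)
    with xs show ?thesis
      by (intro exI[of _ "a # zs"]) (auto simp: successively_append_iff)
  next
    case False
    with xs step(1) show ?thesis
      by (intro exI[of _ "a # xs"]) (auto simp: successively_Cons)
  qed
qed

text \<open>A detour from \<open>a\<close> to \<open>b\<close> that avoids the edge would be closed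
  to a cycle by the edge.\<close>

lemma acyclic_edge_is_bridge:
  assumes "\<nexists>xs. is_cycle E xs" "{a, b} \<in> E" "a \<noteq> b"
  shows "\<not> (\<lambda>x y. {x, y} \<in> E - {{a, b}})\<^sup>*\<^sup>* a b"
proof
  assume "(\<lambda>x y. {x, y} \<in> E - {{a, b}})\<^sup>*\<^sup>* a b"
  from rtranclp_distinct_path[OF this]
  obtain xs where xs: "xs \<noteq> []" "distinct xs" "hd xs = a" "last xs = b"
    "successively (\<lambda>x y. {x, y} \<in> E - {{a, b}}) xs"
    by (elim exE conjE) 
  have nth: "{xs ! i, xs ! Suc i} \<in> E - {{a, b}}" if "Suc i < length xs" for i
    using xs(5) that unfolding successively_conv_nth by blast
  have hd: "xs ! 0 = a" and last: "xs ! (length xs - 1) = b"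
    using xs(1,3,4) by (simp_all add: hd_conv_nth last_conv_nth)
  \<comment> \<open>Two vertices are excluded because the only step would then be the deleted
    edge.\<close>
  have "length xs \<noteq> 0" "length xs \<noteq> 1" "length xs \<noteq> 2"
    using xs(1) hd last assms(3) nth[of 0] by auto
  then have "length xs \<ge> 3" by linarith
  moreover have "{last xs, hd xs} \<in> E"
    using assms(2) xs(3,4) by (simp add: insert_commute)
  ultimately have "is_cycle E xs"
    using xs(2) nth unfolding is_cycle_def by blast
  with assms(1) show False by blast
qed

lemma is_cycle_mono: "is_cycle F xs \<Longrightarrow> F \<subseteq> E \<Longrightarrow> is_cycle E xs"
  unfolding is_cycle_def by blast

text \<open>Only cycles could make the prescribed products inconsistent. Edges are inserted one at a
  time; each new edge is a bridge, so a wrong product is repaired by flipping all signs on one side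
  of it, which leaves the products along the earlier edges unchanged.\<close>

lemma forest_sign_potential:
  fixes g :: "'a set \<Rightarrow> real"
  assumes "finite F" "\<forall>e\<in>F. card e = 2" "\<nexists>xs. is_cycle F xs" "\<forall>e\<in>F. g e = 1 \<or> g e = -1"
  shows "\<exists>s. (\<forall>v. s v = 1 \<or> s v = -1) \<and> (\<forall>u v. {u, v} \<in> F \<longrightarrow> s u * s v = g {u, v})"
  using assms
proof (induction F)
  case empty
  show ?case by (rule exI[of _ "\<lambda>_. 1"]) simp
next
  case (insert e F)
  have "\<nexists>xs. is_cycle F xs" using insert.prems(2) is_cycle_mono by blast
  with insert obtain s where s: "\<forall>v. s v = 1 \<or> s v = -1"
    "\<forall>u v. {u, v} \<in> F \<longrightarrow> s u * s v = g {u, v}" by auto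
  obtain a b where e: "e = {a, b}" "a \<noteq> b"
    using insert.prems(1) by (auto simp: card_2_iff)
  \<comment> \<open>The side of \<open>a\<close> before the new edge is inserted: no edge of
    \<open>F\<close> leaves it, and \<open>b\<close> lies outside.\<close>
  define C where "C = {v. (\<lambda>x y. {x, y} \<in> F)\<^sup>*\<^sup>* a v}"
  have "insert e F - {{a, b}} = F" using insert.hyps(2) e by auto
  then have b: "b \<notin> C" and a: "a \<in> C"
    using acyclic_edge_is_bridge[OF insert.prems(2), of a b] e by (auto simp: C_def)
  have CF: "u \<in> C \<longleftrightarrow> v \<in> C" if "{u, v} \<in> F" for u v
  proof -
    have "{v, u} \<in> F" using that by (simp add: insert_commute)
    with that rtranclp.rtrancl_into_rtrancl[of "\<lambda>x y. {x, y} \<in> F" a]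
    show ?thesis unfolding C_def by blast
  qed
  have ge: "g e = 1 \<or> g e = -1" using insert.prems(3) by simp
  have ext_edge: ?case
    if "\<forall>v. t v = 1 \<or> t v = -1" "\<And>u v. {u, v} \<in> F \<Longrightarrow> t u * t v = g {u, v}" "t a * t b = g e"
    for t :: "'a \<Rightarrow> real"
  proof -
    have "t u * t v = g {u, v}" if "{u, v} = e" for u v
    proof -
      have "u = a \<and> v = b \<or> u = b \<and> v = a" using that e(1) by (auto simp: doubleton_eq_iff)
      then show ?thesis using \<open>t a * t b = g e\<close> that by (metis mult.commute)
    qed
    with that show ?thesis by blast
  qed
  show ?case
  proof (cases "s a * s b = g e")
    case True
    show ?thesis by (rule ext_edge[OF s(1) _ True]) (use s(2) in blast)
  next
    case False
    define s' where "s' v = (if v \<in> C then - s v else s v)" for v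
    have "s' a * s' b = g e"
      using False ge s(1)[rule_format, of a] s(1)[rule_format, of b] a b by (auto simp: s'_def)
    moreover have "s' u * s' v = g {u, v}" if "{u, v} \<in> F" for u v
      using that CF[OF that] s(2) by (auto simp: s'_def)
    moreover have "\<forall>v. s' v = 1 \<or> s' v = -1"
      using s(1) unfolding s'_def by (metis minus_minus)
    ultimately show ?thesis by (intro ext_edge[of s']) auto
  qed
qed

text \<open>Being stuck means that no black node has exactly one white neighbour, so a black node
  with a white neighbour has two. It is enough to give two chosen ones opposite signs; the remaining
  white neighbours may have either sign.\<close>

lemma stuck_tree_signs:
  assumes E: "simple_graph V E" "\<nexists>xs. is_cycle E xs"
    and stuck: "\<nexists>D'. zf_step V E D D'"
  shows "\<exists>\<sigma> :: 'a \<Rightarrow> real. (\<forall>v\<in>D. \<sigma> v = 0) \<and> (\<forall>v. v \<notin> D \<longrightarrow> \<sigma> v = 1 \<or> \<sigma> v = -1) \<and>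
    (\<forall>u v. {u, v} \<in> E \<and> u \<notin> D \<and> v \<notin> D \<longrightarrow> \<sigma> u * \<sigma> v = -1) \<and>
    (\<forall>b\<in>D. \<forall>w. w \<notin> D \<and> {b, w} \<in> E \<longrightarrow> (\<exists>u. {b, u} \<in> E \<and> \<sigma> u = - \<sigma> w))"
proof -
  have VE: "u \<in> V" "v \<in> V" if "{u, v} \<in> E" for u v
    using E(1) that unfolding simple_graph_def by blast+
  have "\<forall>b. \<exists>u w. b \<in> D \<and> (\<exists>x. x \<notin> D \<and> {b, x} \<in> E) \<longrightarrow>
      u \<notin> D \<and> w \<notin> D \<and> {b, u} \<in> E \<and> {b, w} \<in> E \<and> u \<noteq> w"
  proof
    fix b
    show "\<exists>u w. b \<in> D \<and> (\<exists>x. x \<notin> D \<and> {b, x} \<in> E) \<longrightarrow>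
      u \<notin> D \<and> w \<notin> D \<and> {b, u} \<in> E \<and> {b, w} \<in> E \<and> u \<noteq> w"
    proof (cases "b \<in> D \<and> (\<exists>x. x \<notin> D \<and> {b, x} \<in> E)")
      case True
      then obtain x where x: "b \<in> D" "x \<notin> D" "{b, x} \<in> E" by blast
      have "{u \<in> V - D. {b, u} \<in> E} \<noteq> {x}"
        using stuck x(1) zf_step.intros[of b D V E x] by blast
      with x VE obtain y where "y \<notin> D" "{b, y} \<in> E" "y \<noteq> x" by blast
      with x show ?thesis by blast
    qed auto
  qed
  then obtain f h where fh: "\<And>b x. b \<in> D \<Longrightarrow> x \<notin> D \<Longrightarrow> {b, x} \<in> E \<Longrightarrow>
      f b \<notin> D \<and> h b \<notin> D \<and> {b, f b} \<in> E \<and> {b, h b} \<in> E \<and> f b \<noteq> h b"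
    by metis
  \<comment> \<open>The potential also passes through black nodes: it changes sign between \<open>b\<close> and \<open>h b\<close> but not
    between \<open>b\<close> and \<open>f b\<close>, so \<open>f b\<close> and \<open>h b\<close> get opposite signs.\<close>
  define g :: "'a set \<Rightarrow> real" where
    "g e = (if (\<exists>b\<in>D. e = {b, h b} \<and> h b \<notin> D) \<or> e \<inter> D = {} then -1 else 1)" for e
  have "finite E" using E(1) unfolding simple_graph_def
    by (meson Pow_iff finite_Pow_iff finite_subset subsetI)
  moreover have "\<forall>e\<in>E. card e = 2" using E(1) by (auto simp: simple_graph_def)
  moreover have g: "\<forall>e\<in>E. g e = 1 \<or> g e = -1" by (simp add: g_def)
  ultimately obtain s where s: "\<And>v. s v = 1 \<or> s v = -1"
    "\<And>u v. {u, v} \<in> E \<Longrightarrow> s u * s v = g {u, v}"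
    using forest_sign_potential[of E g, OF _ _ E(2)] g by metis
  define \<sigma> where "\<sigma> v = (if v \<in> D then 0 else s v)" for v
  have "\<exists>u. {b, u} \<in> E \<and> \<sigma> u = - \<sigma> w" if bw: "b \<in> D" "w \<notin> D" "{b, w} \<in> E" for b w
  proof -
    note F = fh[OF bw]
    have "g {b, h b} = -1" using F bw(1) by (auto simp: g_def)
    \<comment> \<open>\<open>f b\<close> is white, so \<open>{b, f b}\<close> could be a
      sign-changing edge only through \<open>b\<close> itself, that is if
      \<open>f b = h b\<close>.\<close>
    moreover have "g {b, f b} = 1" using F bw(1) by (auto simp: g_def doubleton_eq_iff)
    ultimately have "s b * s (h b) = -1" "s b * s (f b) = 1" using s(2) F by metis+
    then have "s (h b) = - s (f b)"
      using s(1)[of b] by auto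
    \<comment> \<open>Whichever sign \<open>w\<close> carries, one of the two opposite signs is its
      negative.\<close>
    then have "\<sigma> (f b) = - \<sigma> w \<or> \<sigma> (h b) = - \<sigma> w"
      using F bw s(1)[of w] s(1)[of "f b"] by (auto simp: \<sigma>_def)
    with F show ?thesis by blast
  qed
  moreover have "\<sigma> u * \<sigma> v = -1" if "{u, v} \<in> E" "u \<notin> D" "v \<notin> D" for u v
  proof -
    have "g {u, v} = -1" using that by (auto simp: g_def)
    with s(2)[OF that(1)] that show ?thesis by (simp add: \<sigma>_def)
  qed
  ultimately show ?thesis using s(1) by (intro exI[of _ \<sigma>]) (auto simp: \<sigma>_def)
qed

section \<open>Barbalat's lemma\<close>

definition bdd_on_pos :: "(real \<Rightarrow> real) \<Rightarrow> bool" where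
  "bdd_on_pos f \<longleftrightarrow> (\<exists>K. \<forall>t\<ge>0. \<bar>f t\<bar> \<le> K)"

definition deriv_on_pos :: "(real \<Rightarrow> real) \<Rightarrow> (real \<Rightarrow> real) \<Rightarrow> bool" where
  "deriv_on_pos f g \<longleftrightarrow> (\<forall>t\<ge>0. (f has_real_derivative g t) (at t within {0..}))"

text \<open>The regularity that Barbalat's lemma asks of a derivative. These functions form an
  algebra containing the constants, so membership of forces and dissipation follows from their shape
  once the states are known to belong.\<close>

definition bdd_C1 :: "(real \<Rightarrow> real) \<Rightarrow> bool" where
  "bdd_C1 f \<longleftrightarrow> bdd_on_pos f \<and> (\<exists>g. deriv_on_pos f g \<and> bdd_on_pos g)"

lemma bdd_on_pos_const [simp]: "bdd_on_pos (\<lambda>_. c)"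
  unfolding bdd_on_pos_def by auto

lemma bdd_on_pos_add:
  assumes "bdd_on_pos f" "bdd_on_pos g"
  shows "bdd_on_pos (\<lambda>t. f t + g t)"
proof -
  obtain K L where "\<forall>t\<ge>0. \<bar>f t\<bar> \<le> K" "\<forall>t\<ge>0. \<bar>g t\<bar> \<le> L"
    using assms by (auto simp: bdd_on_pos_def)
  then show ?thesis unfolding bdd_on_pos_def
    by (intro exI[of _ "K + L"]) (smt (verit))
qed

lemma bdd_on_pos_mult:
  assumes "bdd_on_pos f" "bdd_on_pos g"
  shows "bdd_on_pos (\<lambda>t. f t * g t)"
proof -
  obtain K L where "\<forall>t\<ge>0. \<bar>f t\<bar> \<le> K" "\<forall>t\<ge>0. \<bar>g t\<bar> \<le> L"
    using assms by (auto simp: bdd_on_pos_def)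
  then show ?thesis unfolding bdd_on_pos_def abs_mult
    by (intro exI[of _ "K * L"]) (meson abs_ge_zero mult_mono order_trans)
qed

lemma bdd_on_pos_sum:
  "(\<And>i. i \<in> A \<Longrightarrow> bdd_on_pos (f i)) \<Longrightarrow> bdd_on_pos (\<lambda>t. \<Sum>i\<in>A. f i t)"
  by (induction A rule: infinite_finite_induct) (auto intro: bdd_on_pos_add)

lemma bdd_C1_const [simp]: "bdd_C1 (\<lambda>_. c)"
  unfolding bdd_C1_def deriv_on_pos_def by (auto intro!: exI[of _ "\<lambda>_. 0"])

lemma bdd_C1_add:
  assumes "bdd_C1 f" "bdd_C1 g"
  shows "bdd_C1 (\<lambda>t. f t + g t)"
proof -
  obtain f' g' where "deriv_on_pos f f'" "bdd_on_pos f'" "deriv_on_pos g g'" "bdd_on_pos g'"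
    using assms by (auto simp: bdd_C1_def)
  then show ?thesis using assms unfolding bdd_C1_def deriv_on_pos_def
    by (intro conjI bdd_on_pos_add exI[of _ "\<lambda>t. f' t + g' t"] allI impI DERIV_add) auto
qed

lemma bdd_C1_mult:
  assumes "bdd_C1 f" "bdd_C1 g"
  shows "bdd_C1 (\<lambda>t. f t * g t)"
proof -
  obtain f' g' where "deriv_on_pos f f'" "bdd_on_pos f'" "deriv_on_pos g g'" "bdd_on_pos g'"
    using assms by (auto simp: bdd_C1_def)
  then show ?thesis using assms unfolding bdd_C1_def deriv_on_pos_def
    by (intro conjI bdd_on_pos_add bdd_on_pos_mult exI[of _ "\<lambda>t. f' t * g t + g' t * f t"]
        allI impI DERIV_mult) auto
qed

lemma bdd_C1_sum:
  "(\<And>i. i \<in> A \<Longrightarrow> bdd_C1 (f i)) \<Longrightarrow> bdd_C1 (\<lambda>t. \<Sum>i\<in>A. f i t)"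
  by (induction A rule: infinite_finite_induct) (auto intro: bdd_C1_add)

lemma bdd_on_pos_cmult: "bdd_on_pos f \<Longrightarrow> bdd_on_pos (\<lambda>t. c * f t)"
  by (rule bdd_on_pos_mult) simp

lemma bdd_C1_cmult: "bdd_C1 f \<Longrightarrow> bdd_C1 (\<lambda>t. c * f t)"
  by (rule bdd_C1_mult) simp

lemma deriv_on_pos_at:
  assumes "deriv_on_pos f g" "t > 0"
  shows "(f has_real_derivative g t) (at t)"
proof -
  have "(f has_real_derivative g t) (at t within {0<..})"
    by (rule DERIV_subset[where s = "{0..}"]) (use assms in \<open>auto simp: deriv_on_pos_def\<close>)
  then show ?thesis using assms(2) by (simp add: at_within_open[of t "{0<..}"])
qed

text \<open>Over a short interval the convergent \<open>f\<close> changes little, so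
  \<open>g\<close> is small at some point of it by the mean value theorem; the bound on the
  derivative of \<open>g\<close> carries this back to the left end.\<close>

lemma barbalat:
  assumes fg: "deriv_on_pos f g" and g: "bdd_C1 g" and lim: "(f \<longlongrightarrow> L) at_top"
  shows "(g \<longlongrightarrow> 0) at_top"
proof -
  obtain h K where h: "deriv_on_pos g h" "\<And>t. t \<ge> 0 \<Longrightarrow> \<bar>h t\<bar> \<le> K"
    using g by (auto simp: bdd_C1_def bdd_on_pos_def)
  \<comment> \<open>Made positive so that it may be divided by.\<close>
  define K' where "K' = \<bar>K\<bar> + 1"
  have K': "K' > 0" "\<And>t. t \<ge> 0 \<Longrightarrow> \<bar>h t\<bar> \<le> K'" using h(2) unfolding K'_def by force+
  show ?thesis
  proof (rule tendstoI)
    fix e :: real assume e: "e > 0"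
    \<comment> \<open>Within length \<open>d\<close>, \<open>g\<close> varies by at most
      \<open>d * K' = e / 2\<close>. The tolerance \<open>d * e / 4\<close> below keeps the
      increment of \<open>f\<close> under \<open>d * e / 2\<close>, which leaves the other
      \<open>e / 2\<close> for the mean slope.\<close>
    define d where "d = e / (2 * K')"
    have d: "d > 0" using e K' by (simp add: d_def)
    have "\<forall>\<^sub>F t in at_top. dist (f t) L < d * e / 4"
      using lim d e by (intro tendstoD) auto
    then obtain T where T: "\<And>t. t \<ge> T \<Longrightarrow> dist (f t) L < d * e / 4"
      by (auto simp: eventually_at_top_linorder)
    \<comment> \<open>The 1 keeps \<open>t\<close> away from 0, where the derivatives are only
      one-sided.\<close>
    have "dist (g t) 0 < e" if t: "t \<ge> max T 1" for t
    proof -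
      obtain z where z: "z > t" "z < t + d" "f (t + d) - f t = d * g z"
        using MVT2[of t "t + d" f g] d t deriv_on_pos_at[OF fg] by auto
      obtain y where y: "y > t" "y < z" "g z - g t = (z - t) * h y"
        using MVT2[of t z g h] z t deriv_on_pos_at[OF h(1)] by auto
      have "\<bar>d * g z\<bar> < d * (e / 2)"
        using T[of t] T[of "t + d"] z(3)[symmetric] t d unfolding dist_real_def by linarith
      then have "\<bar>g z\<bar> < e / 2" using d by (simp add: abs_mult)
      moreover have "\<bar>g z - g t\<bar> \<le> d * K'"
        unfolding y(3) abs_mult using z y t K'(2)[of y] d by (intro mult_mono) auto
      moreover have "d * K' = e / 2" using K' by (simp add: d_def)
      ultimately show ?thesis unfolding dist_real_def by linarith
    qed
    then show "\<forall>\<^sub>F t in at_top. dist (g t) 0 < e"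
      unfolding eventually_at_top_linorder by blast
  qed
qed

section \<open>Dissipative systems\<close>

text \<open>The two cross terms merge by symmetry. They are grouped as \<open>y\<close> against
  \<open>R x\<close> because a unit vector will be put for \<open>y\<close>, which isolates one
  component of \<open>R x\<close>.\<close>

lemma quadratic_form_add:
  fixes R :: "nat \<Rightarrow> nat \<Rightarrow> real"
  assumes sym: "\<And>a b. a < n \<Longrightarrow> b < n \<Longrightarrow> R a b = R b a"
  shows "(\<Sum>a<n. \<Sum>b<n. (x a + s * y a) * R a b * (x b + s * y b)) =
    (\<Sum>a<n. \<Sum>b<n. x a * R a b * x b) + 2 * s * (\<Sum>a<n. y a * (\<Sum>b<n. R a b * x b)) +
    s\<^sup>2 * (\<Sum>a<n. \<Sum>b<n. y a * R a b * y b)"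
proof -
  have "(\<Sum>a<n. \<Sum>b<n. x a * R a b * y b) = (\<Sum>b<n. \<Sum>a<n. x a * R a b * y b)"
    by (rule sum.swap)
  also have "\<dots> = (\<Sum>a<n. \<Sum>b<n. y a * R a b * x b)"
    by (intro sum.cong refl) (simp add: sym mult_ac)
  finally have sw: "(\<Sum>a<n. \<Sum>b<n. x a * R a b * y b) = (\<Sum>a<n. \<Sum>b<n. y a * R a b * x b)" .
  have "(\<Sum>a<n. \<Sum>b<n. (x a + s * y a) * R a b * (x b + s * y b)) =
    (\<Sum>a<n. \<Sum>b<n. x a * R a b * x b) + s * (\<Sum>a<n. \<Sum>b<n. x a * R a b * y b) +
    s * (\<Sum>a<n. \<Sum>b<n. y a * R a b * x b) + s\<^sup>2 * (\<Sum>a<n. \<Sum>b<n. y a * R a b * y b)"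
    by (simp add: sum_distrib_left sum.distrib[symmetric] algebra_simps power2_eq_square)
  then show ?thesis unfolding sw by (simp add: sum_distrib_left algebra_simps)
qed

text \<open>The form is nonnegative at \<open>x\<close> plus any multiple of the \<open>a\<close>-th
  unit vector. This is how vanishing dissipation controls \<open>R v\<close> coordinate by
  coordinate, without a square root of \<open>R\<close>.\<close>

lemma psd_image_bound:
  fixes R :: "nat \<Rightarrow> nat \<Rightarrow> real"
  assumes sym: "\<And>a b. a < n \<Longrightarrow> b < n \<Longrightarrow> R a b = R b a"
    and psd: "\<And>x. 0 \<le> (\<Sum>a<n. \<Sum>b<n. x a * R a b * x b)"
    and a: "a < n"
  shows "(\<Sum>b<n. R a b * x b)\<^sup>2 \<le> (\<Sum>a<n. \<Sum>b<n. x a * R a b * x b) * (R a a + 1)\<^sup>2"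
proof -
  define Q where "Q x = (\<Sum>a<n. \<Sum>b<n. x a * R a b * x b)" for x
  define w where "w = (\<Sum>b<n. R a b * x b)"
  define e where "e b = (if b = a then 1 else 0 :: real)" for b
  have e1: "(\<Sum>b<n. e b * f b) = f a" for f
    using a by (simp add: e_def if_distrib[of "\<lambda>x. x * _"] cong: if_cong)
  have Qe: "Q e = R a a"
  proof -
    have "Q e = (\<Sum>c<n. e c * (\<Sum>b<n. e b * R c b))"
      unfolding Q_def by (simp add: sum_distrib_left mult_ac)
    then show ?thesis by (simp add: e1)
  qed
  have Raa: "R a a \<ge> 0" using psd[of e] Qe by (simp add: Q_def)
  have "Q (\<lambda>b. x b + s * e b) = Q x + 2 * s * w + s\<^sup>2 * R a a" for s
    using quadratic_form_add[of n R x s e] sym Qe unfolding Q_def w_def by (simp add: e1)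
  then have ge: "0 \<le> Q x + 2 * s * w + s\<^sup>2 * R a a" for s
    using psd[of "\<lambda>b. x b + s * e b"] by (simp add: Q_def)
  define k where "k = R a a + 1"
  have k: "k \<ge> 1" using Raa by (simp add: k_def)
  \<comment> \<open>The bound only needs some valid value of \<open>s\<close>; this one avoids the case \<open>R a a = 0\<close>.\<close>
  have "0 \<le> (Q x + 2 * (- w / k) * w + (- w / k)\<^sup>2 * (k - 1)) * k\<^sup>2"
    using ge[of "- w / k"] by (intro mult_nonneg_nonneg) (simp_all add: k_def)
  also have "\<dots> = Q x * k\<^sup>2 - w\<^sup>2 * (k + 1)"
    using k by (simp add: field_simps power2_eq_square)
  finally have "w\<^sup>2 * (k + 1) \<le> Q x * k\<^sup>2" by simp
  moreover have "w\<^sup>2 * 1 \<le> w\<^sup>2 * (k + 1)" using k by (intro mult_left_mono) auto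
  ultimately show ?thesis by (simp add: Q_def w_def k_def)
qed

text \<open>One fixed trajectory in scalar coordinates: \<open>M\<close> and \<open>W\<close> are
  the diagonals of the mass and stiffness matrices, \<open>G\<close> is the incidence matrix acting
  on all components.\<close>

locale dissipative_system =
  fixes n m :: nat and R G :: "nat \<Rightarrow> nat \<Rightarrow> real" and M W :: "nat \<Rightarrow> real"
    and p q :: "nat \<Rightarrow> real \<Rightarrow> real"
  assumes M_pos: "a < n \<Longrightarrow> M a > 0" and W_pos: "l < m \<Longrightarrow> W l > 0"
    and R_sym: "a < n \<Longrightarrow> b < n \<Longrightarrow> R a b = R b a"
    and R_psd: "0 \<le> (\<Sum>a<n. \<Sum>b<n. x a * R a b * x b)"
    and p_deriv: "a < n \<Longrightarrow> deriv_on_pos (p a)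
      (\<lambda>t. - (\<Sum>b<n. R a b * (p b t / M b)) - (\<Sum>l<m. G a l * W l * q l t))"
    and q_deriv: "l < m \<Longrightarrow> deriv_on_pos (q l) (\<lambda>t. \<Sum>a<n. G a l * (p a t / M a))"
begin

definition v :: "nat \<Rightarrow> real \<Rightarrow> real" where "v a t = p a t / M a"

definition damping :: "nat \<Rightarrow> real \<Rightarrow> real" where "damping a t = (\<Sum>b<n. R a b * v b t)"

text \<open>The net edge force at coordinate \<open>a\<close>, that is the term
  \<open>BB W q\<close> of the equation of motion.\<close>

definition flow :: "nat \<Rightarrow> real \<Rightarrow> real" where "flow a t = (\<Sum>l<m. G a l * W l * q l t)"

definition energy :: "real \<Rightarrow> real" where
  "energy t = ((\<Sum>a<n. (p a t)\<^sup>2 / M a) + (\<Sum>l<m. W l * (q l t)\<^sup>2)) / 2"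

definition dissipation :: "real \<Rightarrow> real" where
  "dissipation t = (\<Sum>a<n. \<Sum>b<n. v a t * R a b * v b t)"

lemma p_deriv': "a < n \<Longrightarrow> deriv_on_pos (p a) (\<lambda>t. - damping a t - flow a t)"
  using p_deriv by (simp add: damping_def flow_def v_def)

lemma q_deriv': "l < m \<Longrightarrow> deriv_on_pos (q l) (\<lambda>t. \<Sum>a<n. G a l * v a t)"
  using q_deriv by (simp add: v_def)

text \<open>The coupling through \<open>G\<close> is skew: the power that the nodes lose to the
  edges is exactly what the edges store, so after exchanging the sums only friction remains.\<close>

lemma energy_deriv: "deriv_on_pos energy (\<lambda>t. - dissipation t)"
  unfolding deriv_on_pos_def
proof (intro allI impI)
  fix t :: real assume t: "t \<ge> 0"
  have p: "((\<lambda>t. (p a t)\<^sup>2 / M a) has_real_derivative 2 * (v a t * (- damping a t - flow a t)))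
    (at t within {0..})" if "a < n" for a
  proof -
    have "(p a has_real_derivative - damping a t - flow a t) (at t within {0..})"
      using p_deriv'[OF that] t by (simp add: deriv_on_pos_def)
    from DERIV_cdivide[OF DERIV_power[OF this, of 2], of "M a"]
    show ?thesis by (simp add: v_def algebra_simps power2_eq_square diff_divide_distrib)
  qed
  have q: "((\<lambda>t. W l * (q l t)\<^sup>2) has_real_derivative 2 * (W l * q l t * (\<Sum>a<n. G a l * v a t)))
    (at t within {0..})" if "l < m" for l
  proof -
    have "(q l has_real_derivative (\<Sum>a<n. G a l * v a t)) (at t within {0..})"
      using q_deriv'[OF that] t by (simp add: deriv_on_pos_def)
    from DERIV_cmult[OF DERIV_power[OF this, of 2], of "W l"]
    show ?thesis by (simp add: algebra_simps)
  qed
  have "(energy has_real_derivative ((\<Sum>a<n. 2 * (v a t * (- damping a t - flow a t))) +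
      (\<Sum>l<m. 2 * (W l * q l t * (\<Sum>a<n. G a l * v a t)))) / 2) (at t within {0..})"
    unfolding energy_def using p q by (intro DERIV_cdivide DERIV_add DERIV_sum) auto
  moreover have "((\<Sum>a<n. 2 * (v a t * (- damping a t - flow a t))) +
      (\<Sum>l<m. 2 * (W l * q l t * (\<Sum>a<n. G a l * v a t)))) / 2 = - dissipation t"
  proof -
    have "(\<Sum>l<m. W l * q l t * (\<Sum>a<n. G a l * v a t)) = (\<Sum>l<m. \<Sum>a<n. v a t * (G a l * W l * q l t))"
      by (simp add: sum_distrib_left mult_ac)
    also have "\<dots> = (\<Sum>a<n. v a t * flow a t)"
      by (subst sum.swap) (simp add: flow_def sum_distrib_left)
    finally have "(\<Sum>l<m. W l * q l t * (\<Sum>a<n. G a l * v a t)) = (\<Sum>a<n. v a t * flow a t)" .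
    moreover have "(\<Sum>a<n. v a t * damping a t) = dissipation t"
      by (simp add: dissipation_def damping_def sum_distrib_left mult_ac)
    ultimately show ?thesis
      by (simp add: sum_distrib_left[symmetric] right_diff_distrib sum_subtractf sum_negf)
  qed
  ultimately show "(energy has_real_derivative - dissipation t) (at t within {0..})" by simp
qed

section \<open>Boundedness of the states by the energy\<close>

lemma two_energy: "2 * energy t = (\<Sum>a<n. (p a t)\<^sup>2 / M a) + (\<Sum>l<m. W l * (q l t)\<^sup>2)"
  unfolding energy_def by simp

lemma energy_antimono:
  assumes "0 \<le> s" "s \<le> t"
  shows "energy t \<le> energy s"
\<comment> \<open>At time 0 the derivative is one-sided, hence two-sided derivatives in the open
  interval and mere continuity at its ends.\<close>
proof (rule DERIV_nonpos_imp_decreasing_open[OF assms(2)])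
  fix x assume "s < x" "x < t"
  then show "\<exists>y. (energy has_real_derivative y) (at x) \<and> y \<le> 0"
    using deriv_on_pos_at[OF energy_deriv, of x] R_psd[of "\<lambda>a. v a x"] assms(1)
    by (intro exI[of _ "- dissipation x"]) (simp add: dissipation_def)
next
  have "continuous_on {0..} energy"
    using energy_deriv unfolding deriv_on_pos_def continuous_on_eq_continuous_within
    by (meson DERIV_continuous atLeast_iff)
  then show "continuous_on {s..t} energy"
    by (rule continuous_on_subset) (use assms in auto)
qed

lemma energy_nonneg: "energy t \<ge> 0"
  unfolding energy_def using M_pos W_pos
  by (intro divide_nonneg_nonneg add_nonneg_nonneg sum_nonneg mult_nonneg_nonneg)
    (auto simp: less_imp_le)

lemma p_sq_le: "a < n \<Longrightarrow> (p a t)\<^sup>2 \<le> 2 * M a * energy t"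
proof -
  assume a: "a < n"
  have "(p a t)\<^sup>2 / M a \<le> (\<Sum>a<n. (p a t)\<^sup>2 / M a)"
    using a M_pos by (intro member_le_sum) (auto simp: less_imp_le)
  moreover have "0 \<le> (\<Sum>l<m. W l * (q l t)\<^sup>2)"
    using W_pos by (intro sum_nonneg mult_nonneg_nonneg) (auto simp: less_imp_le)
  ultimately have "(p a t)\<^sup>2 / M a \<le> 2 * energy t" unfolding two_energy by linarith
  then show ?thesis using M_pos[OF a] by (simp add: divide_le_eq mult_ac)
qed

lemma q_sq_le: "l < m \<Longrightarrow> (q l t)\<^sup>2 \<le> 2 / W l * energy t"
proof -
  assume l: "l < m"
  have "W l * (q l t)\<^sup>2 \<le> (\<Sum>l<m. W l * (q l t)\<^sup>2)"
    using l W_pos by (intro member_le_sum) (auto simp: less_imp_le)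
  moreover have "0 \<le> (\<Sum>a<n. (p a t)\<^sup>2 / M a)"
    using M_pos by (intro sum_nonneg divide_nonneg_nonneg) (auto simp: less_imp_le)
  ultimately have "W l * (q l t)\<^sup>2 \<le> 2 * energy t" unfolding two_energy by linarith
  then show ?thesis using W_pos[OF l] by (simp add: field_simps)
qed

text \<open>The norm is compared with the energy at time \<open>t\<close> and again at time 0. The
  first factor arises by summing the coordinate bounds, the second by estimating each initial
  coordinate by the full initial norm. The constant depends on the parameters only, as stability
  requires.\<close>

lemma state_bound:
  assumes "t \<ge> 0"
  shows "(\<Sum>a<n. (p a t)\<^sup>2) + (\<Sum>l<m. (q l t)\<^sup>2) \<le>
    ((\<Sum>a<n. M a) + (\<Sum>l<m. 1 / W l)) * ((\<Sum>a<n. 1 / M a) + (\<Sum>l<m. W l)) *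
    ((\<Sum>a<n. (p a 0)\<^sup>2) + (\<Sum>l<m. (q l 0)\<^sup>2))"
proof -
  define P where "P = (\<Sum>a<n. (p a 0)\<^sup>2)"
  define Q where "Q = (\<Sum>l<m. (q l 0)\<^sup>2)"
  have PQ: "P \<ge> 0" "Q \<ge> 0" by (simp_all add: P_def Q_def sum_nonneg)
  have "(\<Sum>a<n. (p a 0)\<^sup>2 / M a) \<le> (\<Sum>a<n. (P + Q) * (1 / M a))"
  proof (rule sum_mono)
    fix a assume a: "a \<in> {..<n}"
    then have "(p a 0)\<^sup>2 \<le> P" unfolding P_def by (intro member_le_sum) auto
    then show "(p a 0)\<^sup>2 / M a \<le> (P + Q) * (1 / M a)"
      using a M_pos[of a] PQ by (simp add: divide_right_mono)
  qed
  moreover have "(\<Sum>l<m. W l * (q l 0)\<^sup>2) \<le> (\<Sum>l<m. (P + Q) * W l)"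
  proof (rule sum_mono)
    fix l assume l: "l \<in> {..<m}"
    then have "(q l 0)\<^sup>2 \<le> Q" unfolding Q_def by (intro member_le_sum) auto
    then show "W l * (q l 0)\<^sup>2 \<le> (P + Q) * W l"
      using l W_pos[of l] PQ by (simp add: mult.commute mult_left_mono)
  qed
  ultimately have E0: "2 * energy 0 \<le> ((\<Sum>a<n. 1 / M a) + (\<Sum>l<m. W l)) * (P + Q)"
    unfolding two_energy sum_distrib_left[symmetric] by (simp add: algebra_simps)
  have nn: "(\<Sum>a<n. M a) + (\<Sum>l<m. 1 / W l) \<ge> 0"
    using M_pos W_pos by (intro add_nonneg_nonneg sum_nonneg) (auto simp: less_imp_le)
  have "(\<Sum>a<n. (p a t)\<^sup>2) + (\<Sum>l<m. (q l t)\<^sup>2) \<le>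
    (\<Sum>a<n. 2 * M a * energy t) + (\<Sum>l<m. 2 / W l * energy t)"
    by (intro add_mono sum_mono p_sq_le q_sq_le) auto
  also have "\<dots> = ((\<Sum>a<n. M a) + (\<Sum>l<m. 1 / W l)) * (2 * energy t)"
    by (simp only: sum_distrib_right distrib_right) (simp add: mult_ac)
  also have "\<dots> \<le> ((\<Sum>a<n. M a) + (\<Sum>l<m. 1 / W l)) * (2 * energy 0)"
    using energy_antimono[of 0 t] assms nn by (intro mult_left_mono) auto
  also have "\<dots> \<le> ((\<Sum>a<n. M a) + (\<Sum>l<m. 1 / W l)) *
      (((\<Sum>a<n. 1 / M a) + (\<Sum>l<m. W l)) * (P + Q))"
    using E0 nn by (intro mult_left_mono) auto
  finally show ?thesis by (simp add: P_def Q_def mult_ac)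
qed

lemma bdd_of_sq_le:
  assumes "\<And>t. (f t)\<^sup>2 \<le> c * energy t" "c \<ge> 0"
  shows "bdd_on_pos f"
  unfolding bdd_on_pos_def
proof (intro exI[of _ "sqrt (c * energy 0)"] allI impI)
  fix t :: real assume "t \<ge> 0"
  then have "c * energy t \<le> c * energy 0"
    using energy_antimono[of 0 t] assms(2) by (intro mult_left_mono) auto
  then have "(f t)\<^sup>2 \<le> c * energy 0" using assms(1)[of t] by linarith
  then show "\<bar>f t\<bar> \<le> sqrt (c * energy 0)" by (intro real_le_rsqrt) simp
qed

lemma p_bdd: "a < n \<Longrightarrow> bdd_on_pos (p a)"
  using p_sq_le[of a] M_pos[of a] by (intro bdd_of_sq_le[of "p a" "2 * M a"]) auto

lemma q_bdd: "l < m \<Longrightarrow> bdd_on_pos (q l)"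
  using q_sq_le[of l] W_pos[of l] by (intro bdd_of_sq_le[of "q l" "2 / W l"]) auto

lemma v_bdd: "a < n \<Longrightarrow> bdd_on_pos (v a)"
  using bdd_on_pos_cmult[OF p_bdd, of a "1 / M a"] unfolding v_def[abs_def] by simp

lemma p_C1:
  assumes "a < n" shows "bdd_C1 (p a)"
proof -
  have "bdd_on_pos (\<lambda>t. - 1 * damping a t + - 1 * flow a t)"
    unfolding damping_def flow_def
    by (intro bdd_on_pos_add bdd_on_pos_cmult bdd_on_pos_sum v_bdd q_bdd) auto
  with p_deriv'[OF assms] p_bdd[OF assms] show ?thesis by (auto simp: bdd_C1_def)
qed

lemma q_C1:
  assumes "l < m" shows "bdd_C1 (q l)"
proof -
  have "bdd_on_pos (\<lambda>t. \<Sum>a<n. G a l * v a t)"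
    by (intro bdd_on_pos_cmult bdd_on_pos_sum v_bdd) auto
  with q_deriv'[OF assms] q_bdd[OF assms] show ?thesis by (auto simp: bdd_C1_def)
qed

lemma v_C1: "a < n \<Longrightarrow> bdd_C1 (v a)"
  using bdd_C1_cmult[OF p_C1, of a "1 / M a"] unfolding v_def[abs_def] by simp

section \<open>Limits along the trajectory\<close>

lemma dissipation_tendsto: "(dissipation \<longlongrightarrow> 0) at_top"
proof -
  \<comment> \<open>The energy is monotone only for nonnegative times, so its limit is taken as the
    infimum over these.\<close>
  define L where "L = Inf (energy ` {0..})"
  have bdd: "bdd_below (energy ` {0..})" using energy_nonneg by (intro bdd_belowI[of _ 0]) auto
  have "(energy \<longlongrightarrow> L) at_top"
  proof (rule order_tendstoI)
    fix a assume "a < L"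
    have "a < energy t" if "t \<ge> 0" for t
    proof -
      have "L \<le> energy t" unfolding L_def using bdd that by (intro cInf_lower) auto
      with \<open>a < L\<close> show ?thesis by linarith
    qed
    then show "\<forall>\<^sub>F t in at_top. a < energy t"
      unfolding eventually_at_top_linorder by blast
  next
    fix a assume "L < a"
    then obtain s where s: "s \<ge> 0" "energy s < a"
      unfolding L_def by (subst (asm) cInf_less_iff) (use bdd in auto)
    then have "energy t < a" if "t \<ge> s" for t
      using energy_antimono[of s t] that by linarith
    then show "\<forall>\<^sub>F t in at_top. energy t < a"
      unfolding eventually_at_top_linorder by blast
  qed
  moreover have "bdd_C1 (\<lambda>t. - 1 * dissipation t)"
    unfolding dissipation_def by (intro bdd_C1_cmult bdd_C1_sum bdd_C1_mult v_C1 bdd_C1_const) auto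
  ultimately have "((\<lambda>t. - dissipation t) \<longlongrightarrow> 0) at_top"
    using barbalat[OF energy_deriv] by simp
  then show ?thesis using tendsto_minus by fastforce
qed

text \<open>This covers all coordinates, including those of nodes with a singular block, where the
  velocity itself need not be controlled by the dissipation.\<close>

lemma damping_tendsto:
  assumes "a < n"
  shows "(damping a \<longlongrightarrow> 0) at_top"
proof -
  have "(damping a t)\<^sup>2 \<le> dissipation t * (R a a + 1)\<^sup>2" for t
    using psd_image_bound[of n R a "\<lambda>b. v b t"] R_sym R_psd assms
    by (simp add: damping_def dissipation_def)
  moreover have "((\<lambda>t. dissipation t * (R a a + 1)\<^sup>2) \<longlongrightarrow> 0) at_top"
    using tendsto_mult_right[OF dissipation_tendsto, of "(R a a + 1)\<^sup>2"] by simp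
  ultimately have "((\<lambda>t. (damping a t)\<^sup>2) \<longlongrightarrow> 0) at_top"
    by (intro tendsto_sandwich[of "\<lambda>_. 0" "\<lambda>t. (damping a t)\<^sup>2" _
        "\<lambda>t. dissipation t * (R a a + 1)\<^sup>2"]) simp_all
  then have "((\<lambda>t. sqrt ((damping a t)\<^sup>2)) \<longlongrightarrow> sqrt 0) at_top" by (rule tendsto_real_sqrt)
  then show ?thesis by (simp add: tendsto_rabs_zero_iff)
qed

lemma p_tendsto: "(v a \<longlongrightarrow> 0) at_top \<Longrightarrow> a < n \<Longrightarrow> (p a \<longlongrightarrow> 0) at_top"
  using tendsto_mult_left[of "v a" 0 at_top "M a"] M_pos[of a] by (simp add: v_def)

lemma flow_tendsto:
  assumes "a < n" "(v a \<longlongrightarrow> 0) at_top"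
  shows "(flow a \<longlongrightarrow> 0) at_top"
proof -
  have "bdd_C1 (\<lambda>t. - 1 * damping a t + - 1 * flow a t)"
    unfolding damping_def flow_def
    by (intro bdd_C1_add bdd_C1_cmult bdd_C1_sum v_C1 q_C1) auto
  then have "((\<lambda>t. - damping a t - flow a t) \<longlongrightarrow> 0) at_top"
    using barbalat[OF p_deriv'[OF assms(1)] _ p_tendsto[OF assms(2,1)]] by simp
  from tendsto_minus[OF tendsto_add[OF this damping_tendsto[OF assms(1)]]]
  show ?thesis by simp
qed

text \<open>The entries of the weighted Laplacian \<open>G W G^T\<close>.\<close>

definition stiffness :: "nat \<Rightarrow> nat \<Rightarrow> real" where
  "stiffness a b = (\<Sum>l<m. G a l * W l * G b l)"

lemma flow_deriv: "deriv_on_pos (flow a) (\<lambda>t. \<Sum>b<n. stiffness a b * v b t)"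
  unfolding deriv_on_pos_def
proof (intro allI impI)
  fix t :: real assume t: "t \<ge> 0"
  have "(flow a has_real_derivative (\<Sum>l<m. G a l * W l * (\<Sum>b<n. G b l * v b t))) (at t within {0..})"
    unfolding flow_def using q_deriv' t
    by (intro DERIV_sum DERIV_cmult) (auto simp: deriv_on_pos_def)
  moreover have "(\<Sum>l<m. G a l * W l * (\<Sum>b<n. G b l * v b t)) = (\<Sum>b<n. stiffness a b * v b t)"
    unfolding stiffness_def sum_distrib_left sum_distrib_right
    by (subst sum.swap) (simp add: mult_ac)
  ultimately show "(flow a has_real_derivative (\<Sum>b<n. stiffness a b * v b t)) (at t within {0..})"
    by simp
qed

text \<open>One recoloring in a single coordinate. The nonzero entries in row \<open>a\<close> of
  the Laplacian play the role of the neighbours, and the diagonal entry is among the terms that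
  \<open>other\<close> has to cover.\<close>

lemma forcing:
  assumes a: "a < n" "(v a \<longlongrightarrow> 0) at_top" and w: "w < n" "stiffness a w \<noteq> 0"
    and other: "\<And>b. b < n \<Longrightarrow> b \<noteq> w \<Longrightarrow> stiffness a b \<noteq> 0 \<Longrightarrow> (v b \<longlongrightarrow> 0) at_top"
  shows "(v w \<longlongrightarrow> 0) at_top"
proof -
  have "bdd_C1 (\<lambda>t. \<Sum>b<n. stiffness a b * v b t)"
    by (intro bdd_C1_cmult bdd_C1_sum v_C1) auto
  from barbalat[OF flow_deriv this flow_tendsto[OF a]]
  have all: "((\<lambda>t. \<Sum>b<n. stiffness a b * v b t) \<longlongrightarrow> 0) at_top" .
  have rest: "((\<lambda>t. \<Sum>b\<in>{..<n} - {w}. stiffness a b * v b t) \<longlongrightarrow> 0) at_top"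
  proof (rule tendsto_null_sum)
    fix b assume b: "b \<in> {..<n} - {w}"
    show "((\<lambda>t. stiffness a b * v b t) \<longlongrightarrow> 0) at_top"
      using other[of b] b by (cases "stiffness a b = 0") (auto intro: tendsto_mult_right_zero)
  qed
  have "((\<lambda>t. stiffness a w * v w t) \<longlongrightarrow> 0) at_top"
    using tendsto_diff[OF all rest] w(1) by (simp add: sum.remove[of "{..<n}" w])
  from tendsto_mult_left[OF this, of "1 / stiffness a w"] w(2) show ?thesis by simp
qed

end

section \<open>Matrices in coordinates\<close>

text \<open>The index convention of everything below: \<open>i * r + c\<close> is component
  \<open>c\<close> of block \<open>i\<close>, recovered by \<open>div\<close> and
  \<open>mod\<close>.\<close>

lemma sum_div_mod:
  fixes f :: "nat \<Rightarrow> 'b :: comm_monoid_add"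
  shows "(\<Sum>a<n * r. f a) = (\<Sum>i<n. \<Sum>c<r. f (i * r + c))"
proof (induction n)
  case (Suc n)
  have "(\<Sum>a<Suc n * r. f a) = (\<Sum>a<n * r. f a) + (\<Sum>a=n * r..<n * r + r. f a)"
    by (subst sum.atLeastLessThan_concat[symmetric, of 0 "n * r" "Suc n * r", folded lessThan_atLeast0])
      (simp_all add: lessThan_atLeast0 add.commute)
  also have "(\<Sum>a=n * r..<n * r + r. f a) = (\<Sum>c<r. f (n * r + c))"
    using sum.shift_bounds_nat_ivl[of f 0 "n * r" r] by (simp add: lessThan_atLeast0 add.commute)
  finally show ?case using Suc by simp
qed simp

lemma sum_fixed_mod:
  fixes f :: "nat \<Rightarrow> real"
  assumes "c < r"
  shows "(\<Sum>a<n * r. if a mod r = c then f (a div r) else 0) = (\<Sum>i<n. f i)"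
  using assms by (simp add: sum_div_mod)

lemma mult_add_less:
  fixes r :: nat
  assumes "i < n" "c < r"
  shows "i * r + c < n * r"
proof -
  have "i * r + c < Suc i * r" using assms(2) by simp
  also have "\<dots> \<le> n * r" using assms(1) by (intro mult_le_mono1) simp
  finally show ?thesis .
qed

lemma diag_block_mat_carrier:
  assumes "\<forall>A\<in>set As. A \<in> carrier_mat r r"
  shows "diag_block_mat As \<in> carrier_mat (length As * r) (length As * r)"
  using assms by (induction As) (auto simp: Let_def)

lemma diag_block_mat_index:
  assumes "\<forall>A\<in>set As. A \<in> carrier_mat r r" "a < length As * r" "b < length As * r"
  shows "diag_block_mat As $$ (a, b) =
    (if a div r = b div r then (As ! (a div r)) $$ (a mod r, b mod r) else 0)"
  using assms
proof (induction As arbitrary: a b)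
  case (Cons A As)
  have r: "r > 0" using Cons.prems(2) by (cases r) auto
  have A: "A \<in> carrier_mat r r" using Cons.prems(1) by simp
  have D: "diag_block_mat As \<in> carrier_mat (length As * r) (length As * r)"
    using Cons.prems(1) by (intro diag_block_mat_carrier) auto
  have idx: "diag_block_mat (A # As) $$ (a, b) = (if a < r then if b < r then A $$ (a, b) else 0
      else if b < r then 0 else diag_block_mat As $$ (a - r, b - r))"
    using A D Cons.prems(2,3) by (auto simp: Let_def)
  \<comment> \<open>Dropping the first block lowers the block number by one and keeps the position
    inside the block.\<close>
  have shift: "c div r = Suc ((c - r) div r)" "c mod r = (c - r) mod r" if "\<not> c < r" for c
    using that r by (simp_all add: le_div_geq le_mod_geq)
  consider "a < r" "b < r" | "a < r" "\<not> b < r" | "\<not> a < r" "b < r" | "\<not> a < r" "\<not> b < r"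
    by blast
  then show ?case
  proof cases
    case 4
    have "diag_block_mat As $$ (a - r, b - r) = (if (a - r) div r = (b - r) div r
      then (As ! ((a - r) div r)) $$ ((a - r) mod r, (b - r) mod r) else 0)"
      using Cons.prems 4 by (intro Cons.IH) auto
    then show ?thesis unfolding idx shift[OF 4(1)] shift[OF 4(2)] using 4 by simp
  qed (simp_all add: idx shift del: diag_block_mat.simps)
qed simp

lemma mult_diagonal_right:
  fixes A D :: "real mat"
  assumes "A \<in> carrier_mat n N" "D \<in> carrier_mat N N" "diagonal_mat D" "i < n" "j < N"
  shows "(A * D) $$ (i, j) = A $$ (i, j) * D $$ (j, j)"
proof -
  have "(A * D) $$ (i, j) = (\<Sum>k\<in>{0..<N}. A $$ (i, k) * D $$ (k, j))"
    using assms by (auto simp: scalar_prod_def)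
  also have "\<dots> = (\<Sum>k\<in>{0..<N}. if k = j then A $$ (i, j) * D $$ (j, j) else 0)"
    using assms by (intro sum.cong) (auto simp: diagonal_mat_def)
  also have "\<dots> = A $$ (i, j) * D $$ (j, j)" using assms(5) by simp
  finally show ?thesis .
qed

text \<open>\<open>mat_inverse\<close> returns an option. An explicit two-sided inverse rules out
  \<open>None\<close>, and uniqueness of inverses identifies the returned matrix.\<close>

lemma minv_diagonal:
  fixes M :: "real mat"
  assumes M: "M \<in> carrier_mat N N" "diagonal_mat M" "\<And>a. a < N \<Longrightarrow> M $$ (a, a) > 0"
  shows "minv M = mat N N (\<lambda>(i, j). if i = j then 1 / M $$ (i, i) else 0)" (is "_ = ?D")
proof -
  have D: "?D \<in> carrier_mat N N" "diagonal_mat ?D" by (auto simp: diagonal_mat_def)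
  have MD: "M * ?D = 1\<^sub>m N"
  proof (rule eq_matI)
    fix i j assume "i < dim_row (1\<^sub>m N :: real mat)" "j < dim_col (1\<^sub>m N :: real mat)"
    then show "(M * ?D) $$ (i, j) = 1\<^sub>m N $$ (i, j)"
      using mult_diagonal_right[OF M(1) D] M(2) M(3)[of i] M(1) by (auto simp: diagonal_mat_def)
  qed (use M D in auto)
  have DM: "?D * M = 1\<^sub>m N"
  proof (rule eq_matI)
    fix i j assume "i < dim_row (1\<^sub>m N :: real mat)" "j < dim_col (1\<^sub>m N :: real mat)"
    then show "(?D * M) $$ (i, j) = 1\<^sub>m N $$ (i, j)"
      using mult_diagonal_right[OF D(1) M(1,2)] M(3)[of i] by auto
  qed (use M D in auto)
  show ?thesis
  proof (cases "mat_inverse M")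
    case None
    have "M \<in> Units (ring_mat TYPE(real) N ())"
      using M(1) D(1) MD DM unfolding Units_def ring_mat_def by auto
    with mat_inverse(1)[OF M(1) None, of "()"] show ?thesis by simp
  next
    case (Some X)
    from mat_inverse(2)[OF M(1) Some] have X: "X * M = 1\<^sub>m N" "X \<in> carrier_mat N N" by auto
    have "X = X * (M * ?D)" using X(2) by (simp add: MD)
    also have "\<dots> = (X * M) * ?D" by (rule assoc_mult_mat[OF X(2) M(1) D(1), symmetric])
    also have "\<dots> = ?D" using X(1) D(1) by simp
    finally show ?thesis using Some by simp
  qed
qed

lemma mult_mat_vec_index:
  fixes A :: "real mat"
  assumes "A \<in> carrier_mat n N" "x \<in> carrier_vec N" "i < n"
  shows "(A *\<^sub>v x) $ i = (\<Sum>k<N. A $$ (i, k) * x $ k)"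
  using assms by (auto simp: scalar_prod_def lessThan_atLeast0)

lemma scalar_prod_sum:
  fixes x y :: "real vec"
  assumes "y \<in> carrier_vec N"
  shows "x \<bullet> y = (\<Sum>k<N. x $ k * y $ k)"
  using assms by (auto simp: scalar_prod_def lessThan_atLeast0)

text \<open>An equivalence because both directions are used: one turns a given solution into a
  \<open>dissipative_system\<close>, the other certifies the explicit oscillation as a
  solution.\<close>

lemma solution_iff_components:
  assumes B: "BB \<in> carrier_mat N K"
    and M: "M \<in> carrier_mat N N" "diagonal_mat M" "\<forall>a<N. M $$ (a, a) > 0"
    and W: "W \<in> carrier_mat K K" "diagonal_mat W" and R: "R \<in> carrier_mat N N"
  shows "solution BB M W R p q \<longleftrightarrow> (\<forall>t\<ge>0. p t \<in> carrier_vec N \<and> q t \<in> carrier_vec K) \<and>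
    (\<forall>a<N. deriv_on_pos (\<lambda>t. p t $ a) (\<lambda>t. - (\<Sum>b<N. R $$ (a, b) * (p t $ b / M $$ (b, b))) -
      (\<Sum>l<K. BB $$ (a, l) * W $$ (l, l) * q t $ l))) \<and>
    (\<forall>l<K. deriv_on_pos (\<lambda>t. q t $ l) (\<lambda>t. \<Sum>a<N. BB $$ (a, l) * (p t $ a / M $$ (a, a))))"
proof -
  define D where "D = mat N N (\<lambda>(i, j). if i = j then 1 / M $$ (i, i) else 0)"
  have D: "D \<in> carrier_mat N N" "diagonal_mat D" "\<And>a. a < N \<Longrightarrow> D $$ (a, a) = 1 / M $$ (a, a)"
    by (auto simp: D_def diagonal_mat_def)
  have minv: "minv M = D" unfolding D_def by (rule minv_diagonal) (use M in auto)
  have BT: "transpose_mat BB \<in> carrier_mat K N" using B by simp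
  have RD: "R * D \<in> carrier_mat N N" and BW: "BB * W \<in> carrier_mat N K"
    and BD: "transpose_mat BB * D \<in> carrier_mat K N"
    using R D B W BT by auto
  have e1: "(- ((R * minv M) *\<^sub>v x) - (BB * W) *\<^sub>v y) $ a =
      - (\<Sum>b<N. R $$ (a, b) * (x $ b / M $$ (b, b))) - (\<Sum>l<K. BB $$ (a, l) * W $$ (l, l) * y $ l)"
    if "x \<in> carrier_vec N" "y \<in> carrier_vec K" "a < N" for x y a
  proof -
    have "((R * D) *\<^sub>v x) $ a = (\<Sum>b<N. R $$ (a, b) * (x $ b / M $$ (b, b)))"
      using mult_mat_vec_index[OF RD that(1,3)] that D(3)
      by (simp add: mult_diagonal_right[OF R D(1,2)])
    moreover have "((BB * W) *\<^sub>v y) $ a = (\<Sum>l<K. BB $$ (a, l) * W $$ (l, l) * y $ l)"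
      using mult_mat_vec_index[OF BW that(2,3)] that
      by (simp add: mult_diagonal_right[OF B W])
    moreover have "dim_vec ((R * D) *\<^sub>v x) = N" "dim_vec ((BB * W) *\<^sub>v y) = N"
      using RD BW by auto
    ultimately show ?thesis using that(3) unfolding minv by (simp del: index_mult_mat_vec)
  qed
  have e2: "((transpose_mat BB * minv M) *\<^sub>v x) $ l = (\<Sum>a<N. BB $$ (a, l) * (x $ a / M $$ (a, a)))"
    if "x \<in> carrier_vec N" "l < K" for x l
    using mult_mat_vec_index[OF BD that] that D(3) B unfolding minv
    by (simp add: mult_diagonal_right[OF BT D(1,2)])
  have dims: "dim_row BB = N" "dim_col BB = K"
    "dim_vec (- ((R * minv M) *\<^sub>v x) - (BB * W) *\<^sub>v y) = N"
    "dim_vec ((transpose_mat BB * minv M) *\<^sub>v x) = K" for x y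
    using B by auto
  show ?thesis
    unfolding solution_def vec_deriv_def deriv_on_pos_def dims
    by (auto simp del: index_minus_vec index_uminus_vec index_mult_mat_vec simp: e1 e2)
qed

lemma kronecker_one_carrier:
  "B \<in> carrier_mat n m \<Longrightarrow> kronecker B (1\<^sub>m r) \<in> carrier_mat (n * r) (m * r)"
  by (auto simp: kronecker_def)

lemma kronecker_one_index:
  assumes "B \<in> carrier_mat n m" "a < n * r" "l < m * r"
  shows "kronecker B (1\<^sub>m r) $$ (a, l) = (if l mod r = a mod r then B $$ (a div r, l div r) else 0)"
proof -
  have "r > 0" using assms(2) by (cases r) auto
  then show ?thesis using assms by (auto simp: kronecker_def)
qed

section \<open>Definite matrices and their blocks\<close>

lemma quadratic_form_vec:
  fixes A :: "real mat"
  assumes "A \<in> carrier_mat r r"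
  shows "vec r x \<bullet> (A *\<^sub>v vec r x) = (\<Sum>c<r. \<Sum>d<r. x c * A $$ (c, d) * x d)"
  using assms
  by (subst scalar_prod_sum[of _ r]) (auto simp: mult_mat_vec_index[OF assms] sum_distrib_left mult_ac
      simp del: index_mult_mat_vec)

lemma pos_def_imp_semidef: "pos_def r A \<Longrightarrow> pos_semidef r A"
  unfolding pos_def_def pos_semidef_def
  by (metis less_imp_le mult_mat_vec_carrier order_refl scalar_prod_left_zero)

lemma pos_def_diag_pos:
  assumes "pos_def r A" "c < r"
  shows "A $$ (c, c) > 0"
proof -
  define e where "e d = (if d = c then 1 else 0 :: real)" for d
  have "vec r e $ c \<noteq> 0\<^sub>v r $ c" using assms(2) by (simp add: e_def)
  then have "vec r e \<noteq> 0\<^sub>v r" by metis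
  then have "0 < vec r e \<bullet> (A *\<^sub>v vec r e)" using assms(1) by (auto simp: pos_def_def)
  also have "\<dots> = (\<Sum>c<r. e c * (\<Sum>d<r. e d * A $$ (c, d)))"
    using assms(1) by (subst quadratic_form_vec) (auto simp: pos_def_def sum_distrib_left mult_ac)
  also have "\<dots> = A $$ (c, c)"
    using assms(2) by (simp add: e_def if_distrib[of "\<lambda>x. x * _"] cong: if_cong)
  finally show ?thesis .
qed

text \<open>A kernel vector would make the form vanish, so the determinant is nonzero. The left
  inverse recovers the velocity of a damped node from its friction.\<close>

lemma pos_def_left_inverse:
  assumes "pos_def r A"
  obtains X where "X \<in> carrier_mat r r" "X * A = 1\<^sub>m r"
proof -
  have A: "A \<in> carrier_mat r r" using assms by (simp add: pos_def_def)
  have "det A \<noteq> 0"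
  proof
    assume "det A = 0"
    then obtain x where x: "x \<in> carrier_vec r" "x \<noteq> 0\<^sub>v r" "A *\<^sub>v x = 0\<^sub>v r"
      using det_0_iff_vec_prod_zero[OF A] by blast
    then have "0 < x \<bullet> (0\<^sub>v r)" using assms unfolding pos_def_def by metis
    with x(1) show False by simp
  qed
  from det_non_zero_imp_unit[OF A this, of "()"] show ?thesis
    using that unfolding Units_def ring_mat_def by auto
qed

lemma diag_blocks:
  assumes "length Ms = N" "\<forall>i<N. diagonal_mat (Ms ! i) \<and> pos_def r (Ms ! i)"
  shows "diag_block_mat Ms \<in> carrier_mat (N * r) (N * r)" "diagonal_mat (diag_block_mat Ms)"
    "\<forall>a<N * r. diag_block_mat Ms $$ (a, a) > 0"
proof -
  have C: "\<forall>A\<in>set Ms. A \<in> carrier_mat r r"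
    using assms by (auto simp: in_set_conv_nth pos_def_def)
  show car: "diag_block_mat Ms \<in> carrier_mat (N * r) (N * r)"
    using diag_block_mat_carrier[OF C] assms(1) by simp
  have div: "a div r < N" "a mod r < r" if "a < N * r" for a
    using that by (cases r; simp add: less_mult_imp_div_less)+
  show "diagonal_mat (diag_block_mat Ms)"
    unfolding diagonal_mat_def
  proof (intro allI impI)
    fix a b assume "a < dim_row (diag_block_mat Ms)" "b < dim_col (diag_block_mat Ms)" and ne: "a \<noteq> b"
    then have ab: "a < N * r" "b < N * r" using car by auto
    have "a mod r \<noteq> b mod r" if "a div r = b div r"
      using that ne by (metis div_mult_mod_eq)
    moreover have "Ms ! (a div r) \<in> carrier_mat r r" "diagonal_mat (Ms ! (a div r))"
      using assms div[OF ab(1)] by (auto simp: pos_def_def)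
    ultimately show "diag_block_mat Ms $$ (a, b) = 0"
      using diag_block_mat_index[OF C, of a b] ab assms(1) div[OF ab(1)] div[OF ab(2)]
      by (auto simp: diagonal_mat_def)
  qed
  show "\<forall>a<N * r. diag_block_mat Ms $$ (a, a) > 0"
  proof (intro allI impI)
    fix a assume a: "a < N * r"
    show "diag_block_mat Ms $$ (a, a) > 0"
      using diag_block_mat_index[OF C, of a a] a assms div[OF a] pos_def_diag_pos by auto
  qed
qed

text \<open>The last item is the discrete derivative along an edge: a column paired with a function
  on the nodes gives the difference of the end values.\<close>

lemma incidence_column:
  assumes "oriented_incidence vs es B" "k < length es"
  obtains i j where "i < length vs" "j < length vs" "i \<noteq> j" "es ! k = {vs ! i, vs ! j}"
    "\<And>x. x < length vs \<Longrightarrow> B $$ (x, k) = (if x = i then 1 else if x = j then -1 else 0)"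
    "\<And>f :: nat \<Rightarrow> real. (\<Sum>x<length vs. B $$ (x, k) * f x) = f i - f j"
proof -
  obtain i j where ij: "i < length vs" "j < length vs" "i \<noteq> j" "es ! k = {vs ! i, vs ! j}"
    "B $$ (i, k) = 1" "B $$ (j, k) = -1" "\<forall>l<length vs. l \<noteq> i \<and> l \<noteq> j \<longrightarrow> B $$ (l, k) = 0"
    using assms unfolding oriented_incidence_def by blast
  have col: "B $$ (x, k) = (if x = i then 1 else if x = j then -1 else 0)" if "x < length vs" for x
    using ij that by auto
  have "(\<Sum>x<length vs. B $$ (x, k) * f x) = f i - f j" for f :: "nat \<Rightarrow> real"
  proof -
    have "(\<Sum>x<length vs. B $$ (x, k) * f x) =
      (\<Sum>x<length vs. (if x = i then f i else 0) - (if x = j then f j else 0))"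
      using ij(3) by (intro sum.cong) (auto simp: col)
    then show ?thesis using ij(1,2) by (simp add: sum_subtractf)
  qed
  with ij(1-4) col show ?thesis by (rule that)
qed

text \<open>The ends of an edge carry opposite signs whatever its orientation. Hence off-diagonal
  Laplacian entries are sums of nonpositive terms, in which nothing can cancel.\<close>

lemma incidence_product:
  assumes "oriented_incidence vs es B" "distinct vs" "k < length es"
    "i < length vs" "j < length vs" "i \<noteq> j"
  shows "B $$ (i, k) * B $$ (j, k) = (if es ! k = {vs ! i, vs ! j} then -1 else 0)"
proof -
  obtain i' j' where c: "i' < length vs" "j' < length vs" "i' \<noteq> j'" "es ! k = {vs ! i', vs ! j'}"
    "\<And>x. x < length vs \<Longrightarrow> B $$ (x, k) = (if x = i' then 1 else if x = j' then -1 else 0)"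
    "\<And>f :: nat \<Rightarrow> real. (\<Sum>x<length vs. B $$ (x, k) * f x) = f i' - f j'"
    by (rule incidence_column[OF assms(1,3)], rule that)
  have "es ! k = {vs ! i, vs ! j} \<longleftrightarrow> i = i' \<and> j = j' \<or> i = j' \<and> j = i'"
    using c(1-4) assms(2,4,5) by (auto simp: doubleton_eq_iff nth_eq_iff_index_eq)
  then show ?thesis using c(3) assms(4-6) by (auto simp: c(5))
qed

section \<open>Feasible parameters in coordinates\<close>

lemma feasibleE:
  assumes "feasible r vs es Vd M W R"
  obtains Rs where
    "M \<in> carrier_mat (length vs * r) (length vs * r)" "diagonal_mat M"
    "\<forall>a<length vs * r. M $$ (a, a) > 0"
    "W \<in> carrier_mat (length es * r) (length es * r)" "diagonal_mat W"
    "\<forall>l<length es * r. W $$ (l, l) > 0"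
    "length Rs = length vs" "R = diag_block_mat Rs"
    "\<forall>i<length vs. pos_semidef r (Rs ! i)"
    "\<forall>i<length vs. vs ! i \<in> Vd \<longrightarrow> pos_def r (Rs ! i)"
proof -
  obtain Ms Ws Rs where *: "length Ms = length vs" "length Ws = length es" "length Rs = length vs"
    "M = diag_block_mat Ms" "W = diag_block_mat Ws" "R = diag_block_mat Rs"
    "\<forall>i<length vs. diagonal_mat (Ms ! i) \<and> pos_def r (Ms ! i)"
    "\<forall>k<length es. diagonal_mat (Ws ! k) \<and> pos_def r (Ws ! k)"
    "\<forall>i<length vs. vs ! i \<in> Vd \<longrightarrow> pos_def r (Rs ! i)"
    "\<forall>i<length vs. vs ! i \<notin> Vd \<longrightarrow> pos_semidef r (Rs ! i) \<and> \<not> invertible_mat (Rs ! i)"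
    using assms unfolding feasible_def by (elim exE conjE)
  have "\<forall>i<length vs. pos_semidef r (Rs ! i)"
    using *(9,10) pos_def_imp_semidef by blast
  from that[OF diag_blocks[OF *(1,7), folded *(4)] diag_blocks[OF *(2,8), folded *(5)] *(3,6) this *(9)]
  show ?thesis .
qed

context
  fixes Rs :: "real mat list" and r n :: nat and R
  assumes len: "length Rs = n" and Rs: "\<forall>i<n. pos_semidef r (Rs ! i)"
    and R: "R = diag_block_mat Rs"
begin

lemma psd_blocks_carrier: "\<forall>A\<in>set Rs. A \<in> carrier_mat r r"
  using len Rs by (auto simp: in_set_conv_nth pos_semidef_def)

lemma psd_blocks_apply:
  assumes "i < n" "c < r"
  shows "(\<Sum>b<n * r. R $$ (i * r + c, b) * x b) = (\<Sum>d<r. (Rs ! i) $$ (c, d) * x (i * r + d))"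
proof -
  have "R $$ (i * r + c, j * r + d) = (if i = j then (Rs ! i) $$ (c, d) else 0)"
    if "j < n" "d < r" for j d
    using diag_block_mat_index[OF psd_blocks_carrier, of "i * r + c" "j * r + d"]
      mult_add_less[OF assms] mult_add_less[OF that] assms(2) that(2) len R by simp
  then have "(\<Sum>b<n * r. R $$ (i * r + c, b) * x b) =
    (\<Sum>j<n. \<Sum>d<r. (if i = j then (Rs ! i) $$ (c, d) else 0) * x (j * r + d))"
    unfolding sum_div_mod by (intro sum.cong) auto
  also have "\<dots> = (\<Sum>j<n. if i = j then \<Sum>d<r. (Rs ! i) $$ (c, d) * x (j * r + d) else 0)"
    by (intro sum.cong) auto
  finally show ?thesis using assms(1) by simp
qed

lemma psd_blocks_sym:
  assumes "a < n * r" "b < n * r"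
  shows "R $$ (a, b) = R $$ (b, a)"
proof -
  have div: "a div r < n" "a mod r < r" "b mod r < r"
    using assms by (cases r; simp add: less_mult_imp_div_less)+
  have "Rs ! (a div r) \<in> carrier_mat r r" "transpose_mat (Rs ! (a div r)) = Rs ! (a div r)"
    using Rs div(1) by (auto simp: pos_semidef_def)
  then have "(Rs ! (a div r)) $$ (a mod r, b mod r) = (Rs ! (a div r)) $$ (b mod r, a mod r)"
    using div by (metis carrier_matD index_transpose_mat(1))
  then show ?thesis
    using diag_block_mat_index[OF psd_blocks_carrier, of a b]
      diag_block_mat_index[OF psd_blocks_carrier, of b a] assms len R by simp
qed

lemma psd_blocks_form_nonneg: "0 \<le> (\<Sum>a<n * r. \<Sum>b<n * r. x a * R $$ (a, b) * x b)"
proof -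
  have "(\<Sum>a<n * r. \<Sum>b<n * r. x a * R $$ (a, b) * x b) =
    (\<Sum>a<n * r. x a * (\<Sum>b<n * r. R $$ (a, b) * x b))"
    by (simp add: sum_distrib_left mult_ac)
  also have "\<dots> = (\<Sum>i<n. \<Sum>c<r. x (i * r + c) * (\<Sum>d<r. (Rs ! i) $$ (c, d) * x (i * r + d)))"
    unfolding sum_div_mod[of _ n r, where f = "\<lambda>a. x a * (\<Sum>b<n * r. R $$ (a, b) * x b)"]
    by (intro sum.cong refl) (simp add: psd_blocks_apply)
  also have "\<dots> = (\<Sum>i<n. vec r (\<lambda>c. x (i * r + c)) \<bullet> (Rs ! i *\<^sub>v vec r (\<lambda>c. x (i * r + c))))"
  proof (rule sum.cong[OF refl])
    fix i assume "i \<in> {..<n}"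
    then have "Rs ! i \<in> carrier_mat r r" using Rs by (auto simp: pos_semidef_def)
    from quadratic_form_vec[OF this, of "\<lambda>c. x (i * r + c)"]
    show "(\<Sum>c<r. x (i * r + c) * (\<Sum>d<r. (Rs ! i) $$ (c, d) * x (i * r + d))) =
      vec r (\<lambda>c. x (i * r + c)) \<bullet> (Rs ! i *\<^sub>v vec r (\<lambda>c. x (i * r + c)))"
      by (simp add: sum_distrib_left mult_ac)
  qed
  also have "\<dots> \<ge> 0" using Rs by (intro sum_nonneg) (auto simp: pos_semidef_def)
  finally show ?thesis .
qed

end

lemma state_norm_eq:
  assumes "p \<in> carrier_vec N" "q \<in> carrier_vec K"
  shows "state_norm p q = sqrt ((\<Sum>a<N. (p $ a)\<^sup>2) + (\<Sum>l<K. (q $ l)\<^sup>2))"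
  unfolding state_norm_def scalar_prod_sum[OF assms(1)] scalar_prod_sum[OF assms(2)]
  by (simp add: power2_eq_square)

lemma solution_dissipative:
  assumes B: "B \<in> carrier_mat (length vs) (length es)"
    and feas: "feasible r vs es Vd M W R"
    and sol: "solution (kronecker B (1\<^sub>m r)) M W R p q"
  shows "dissipative_system (length vs * r) (length es * r) (\<lambda>a b. R $$ (a, b))
    (\<lambda>a l. kronecker B (1\<^sub>m r) $$ (a, l)) (\<lambda>a. M $$ (a, a)) (\<lambda>l. W $$ (l, l))
    (\<lambda>a t. p t $ a) (\<lambda>l t. q t $ l)"
    and "\<And>t. t \<ge> 0 \<Longrightarrow> p t \<in> carrier_vec (length vs * r) \<and> q t \<in> carrier_vec (length es * r)"
proof -
  obtain Rs where F: "M \<in> carrier_mat (length vs * r) (length vs * r)" "diagonal_mat M"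
    "\<forall>a<length vs * r. M $$ (a, a) > 0"
    "W \<in> carrier_mat (length es * r) (length es * r)" "diagonal_mat W"
    "\<forall>l<length es * r. W $$ (l, l) > 0"
    "length Rs = length vs" "R = diag_block_mat Rs"
    "\<forall>i<length vs. pos_semidef r (Rs ! i)"
    "\<forall>i<length vs. vs ! i \<in> Vd \<longrightarrow> pos_def r (Rs ! i)"
    by (rule feasibleE[OF feas], rule that)
  have "R \<in> carrier_mat (length vs * r) (length vs * r)"
    using diag_block_mat_carrier[OF psd_blocks_carrier[OF F(7,9,8)]] F(7,8) by simp
  note sol' = sol[unfolded solution_iff_components[OF kronecker_one_carrier[OF B] F(1-5) this]]
  show "p t \<in> carrier_vec (length vs * r) \<and> q t \<in> carrier_vec (length es * r)" if "t \<ge> 0" for t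
    using sol' that by blast
  show "dissipative_system (length vs * r) (length es * r) (\<lambda>a b. R $$ (a, b))
    (\<lambda>a l. kronecker B (1\<^sub>m r) $$ (a, l)) (\<lambda>a. M $$ (a, a)) (\<lambda>l. W $$ (l, l))
    (\<lambda>a t. p t $ a) (\<lambda>l t. q t $ l)"
    using sol' F(3,6) psd_blocks_sym[OF F(7,9,8)] psd_blocks_form_nonneg[OF F(7,9,8)]
    by unfold_locales auto
qed

section \<open>Zero forcing implies stability\<close>

lemma zero_forcing_imp_convergence:
  assumes inc: "oriented_incidence vs es B" and vs: "numbering vs V" and es: "numbering es E"
    and graph: "simple_graph V E" "\<nexists>xs. is_cycle E xs" "Vd \<subseteq> V" and zf: "zero_forcing V Vd E"
    and feas: "feasible r vs es Vd M W R"
    and sol: "solution (kronecker B (1\<^sub>m r)) M W R p q"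
  shows "((\<lambda>t. state_norm (p t) (q t)) \<longlongrightarrow> 0) at_top"
proof -
  define n where "n = length vs"
  define m where "m = length es"
  define G where "G = kronecker B (1\<^sub>m r)"
  have B: "B \<in> carrier_mat n m" using inc by (simp add: oriented_incidence_def n_def m_def)
  have dvs: "distinct vs" "set vs = V" and des: "distinct es" "set es = E"
    using vs es by (auto simp: numbering_def)
  note dis = solution_dissipative[OF B[unfolded n_def m_def] feas sol, folded n_def m_def G_def]
  interpret dissipative_system "n * r" "m * r" "\<lambda>a b. R $$ (a, b)" "\<lambda>a l. G $$ (a, l)"
    "\<lambda>a. M $$ (a, a)" "\<lambda>l. W $$ (l, l)" "\<lambda>a t. p t $ a" "\<lambda>l t. q t $ l"
    by (rule dis(1))
  obtain Rs where F: "M \<in> carrier_mat (n * r) (n * r)" "diagonal_mat M"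
    "\<forall>a<n * r. M $$ (a, a) > 0"
    "W \<in> carrier_mat (m * r) (m * r)" "diagonal_mat W"
    "\<forall>l<m * r. W $$ (l, l) > 0"
    "length Rs = n" "R = diag_block_mat Rs"
    "\<forall>i<n. pos_semidef r (Rs ! i)"
    "\<forall>i<n. vs ! i \<in> Vd \<longrightarrow> pos_def r (Rs ! i)"
    by (rule feasibleE[OF feas, folded n_def m_def], rule that)
  have G: "G $$ (i * r + c, k * r + d) = (if d = c then B $$ (i, k) else 0)"
    if "i < n" "c < r" "k < m" "d < r" for i c k d
    using kronecker_one_index[OF B mult_add_less[OF that(1,2)] mult_add_less[OF that(3,4)]] that(2,4)
    by (simp add: G_def)
  have G_sum: "(\<Sum>l<m * r. G $$ (i * r + c, l) * f l) = (\<Sum>k<m. B $$ (i, k) * f (k * r + c))"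
    if "i < n" "c < r" for i c and f :: "nat \<Rightarrow> real"
  proof -
    have "(\<Sum>l<m * r. G $$ (i * r + c, l) * f l) =
      (\<Sum>k<m. \<Sum>d<r. if d = c then B $$ (i, k) * f (k * r + c) else 0)"
      unfolding sum_div_mod by (intro sum.cong refl) (simp add: G that)
    then show ?thesis using that(2) by simp
  qed

  \<comment> \<open>At a damped node the block of \<open>R\<close> is invertible, so the velocity is
    a fixed linear combination of friction terms, all of which tend to 0.\<close>
  have damped: "(v (i * r + c) \<longlongrightarrow> 0) at_top" if i: "i < n" "vs ! i \<in> Vd" and c: "c < r" for i c
  proof -
    obtain X where X: "X \<in> carrier_mat r r" "X * Rs ! i = 1\<^sub>m r"
      by (rule pos_def_left_inverse[OF F(10)[rule_format, OF i]])
    have Ri: "Rs ! i \<in> carrier_mat r r" using F(10)[rule_format, OF i] by (simp add: pos_def_def)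
    have XR: "(\<Sum>d<r. X $$ (c, d) * (Rs ! i) $$ (d, e)) = (if c = e then 1 else 0)" if "e < r" for e
    proof -
      have "(X * Rs ! i) $$ (c, e) = (\<Sum>d<r. X $$ (c, d) * (Rs ! i) $$ (d, e))"
        using X(1) Ri c that by (auto simp: scalar_prod_def lessThan_atLeast0)
      then show ?thesis using X(2) c that by simp
    qed
    have "v (i * r + c) t = (\<Sum>d<r. X $$ (c, d) * damping (i * r + d) t)" for t
    proof -
      have "(\<Sum>d<r. X $$ (c, d) * damping (i * r + d) t) =
        (\<Sum>d<r. \<Sum>e<r. X $$ (c, d) * (Rs ! i) $$ (d, e) * v (i * r + e) t)"
        by (simp add: damping_def psd_blocks_apply[OF F(7,9,8)] i sum_distrib_left mult_ac)
      also have "\<dots> = (\<Sum>e<r. (\<Sum>d<r. X $$ (c, d) * (Rs ! i) $$ (d, e)) * v (i * r + e) t)"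
        by (subst sum.swap) (simp add: sum_distrib_right)
      also have "\<dots> = (\<Sum>e<r. if c = e then v (i * r + c) t else 0)"
        by (intro sum.cong refl) (simp add: XR)
      finally show ?thesis using c by simp
    qed
    moreover have "((\<lambda>t. \<Sum>d<r. X $$ (c, d) * damping (i * r + d) t) \<longlongrightarrow> 0) at_top"
      by (intro tendsto_null_sum tendsto_mult_right_zero damping_tendsto mult_add_less) (use i in auto)
    ultimately show ?thesis by presburger
  qed

  \<comment> \<open>\<open>G\<close> and \<open>W\<close> do not mix components, so the Laplacian
    splits into one weighted graph Laplacian for each \<open>c\<close>.\<close>
  have stiff: "stiffness (i * r + c) (j * r + d) =
      (if c = d then \<Sum>k<m. B $$ (i, k) * B $$ (j, k) * W $$ (k * r + c, k * r + c) else 0)"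
    if "i < n" "c < r" "j < n" "d < r" for i j c d
  proof -
    have "stiffness (i * r + c) (j * r + d) =
      (\<Sum>k<m. B $$ (i, k) * (W $$ (k * r + c, k * r + c) * G $$ (j * r + d, k * r + c)))"
      unfolding stiffness_def using G_sum[OF that(1,2)] by (simp add: mult.assoc)
    then show ?thesis using that by (auto simp: G mult_ac)
  qed
  have stiff_nonadj: "stiffness (i * r + c) (j * r + d) = 0"
    if "i < n" "c < r" "j < n" "d < r" "i \<noteq> j" "c \<noteq> d \<or> {vs ! i, vs ! j} \<notin> E" for i j c d
  proof (cases "c = d")
    case True
    then have "B $$ (i, k) * B $$ (j, k) = 0" if "k < m" for k
      using incidence_product[OF inc dvs(1), of k i j] that \<open>i < n\<close> \<open>j < n\<close> \<open>i \<noteq> j\<close>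
        \<open>c \<noteq> d \<or> {vs ! i, vs ! j} \<notin> E\<close> des nth_mem[of k es]
      unfolding n_def m_def by auto
    then show ?thesis by (auto simp: stiff that(1-4) intro!: sum.neutral)
  qed (simp add: stiff that)
  have stiff_adj: "stiffness (i * r + c) (j * r + c) \<noteq> 0"
    if "i < n" "j < n" "c < r" "i \<noteq> j" "{vs ! i, vs ! j} \<in> E" for i j c
  proof -
    obtain k where k: "k < m" "es ! k = {vs ! i, vs ! j}"
      using \<open>{vs ! i, vs ! j} \<in> E\<close> des unfolding m_def by (metis in_set_conv_nth)
    have BB: "B $$ (i, k) * B $$ (j, k) = (if es ! k = {vs ! i, vs ! j} then -1 else 0)"
      if "k < m" for k
      using incidence_product[OF inc dvs(1), of k i j] that \<open>i < n\<close> \<open>j < n\<close> \<open>i \<noteq> j\<close>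
      unfolding n_def m_def by auto
    have "(\<Sum>k<m. B $$ (i, k) * B $$ (j, k) * W $$ (k * r + c, k * r + c)) < (\<Sum>k<m. 0)"
    \<comment> \<open>All terms are nonpositive and the one of the edge joining the two nodes is
      negative.\<close>
    proof (rule sum_strict_mono_ex1)
      show "\<forall>k\<in>{..<m}. B $$ (i, k) * B $$ (j, k) * W $$ (k * r + c, k * r + c) \<le> 0"
        using F(6) mult_add_less \<open>c < r\<close> by (auto simp: BB less_imp_le)
      show "\<exists>k\<in>{..<m}. B $$ (i, k) * B $$ (j, k) * W $$ (k * r + c, k * r + c) < 0"
        using F(6)[rule_format, OF mult_add_less[OF k(1) \<open>c < r\<close>]] k by (intro bexI[of _ k]) (simp_all add: BB)
    qed simp
    then show ?thesis by (simp add: stiff that)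
  qed

  \<comment> \<open>Induction along the recoloring: every component of the velocity vanishes in the
    limit at every black node.\<close>
  have spread: "\<forall>i<n. vs ! i \<in> S \<longrightarrow> (\<forall>c<r. (v (i * r + c) \<longlongrightarrow> 0) at_top)"
    if "(zf_step V E)\<^sup>*\<^sup>* Vd S" for S
    using that
  proof (induction rule: rtranclp_induct)
    case base
    then show ?case using damped by blast
  next
    case (step S S')
    have "S \<subseteq> V" using zf_steps_subset[OF step(1) graph(3)] .
    obtain b w where bw: "b \<in> S" "{u \<in> V - S. {b, u} \<in> E} = {w}" "S' = insert w S"
      using step(2) by (auto elim: zf_step.cases)
    have w: "w \<in> V" "w \<notin> S" "{b, w} \<in> E" using bw(2) by blast+
    obtain i where i: "i < n" "vs ! i = b"
      using bw(1) \<open>S \<subseteq> V\<close> dvs(2) unfolding n_def by (metis in_set_conv_nth subsetD)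
    obtain j where j: "j < n" "vs ! j = w"
      using w(1) dvs(2) unfolding n_def by (metis in_set_conv_nth)
    have ij: "i \<noteq> j" using i j w(2) bw(1) by auto
    have "(v (j * r + c) \<longlongrightarrow> 0) at_top" if c: "c < r" for c
    proof (rule forcing[of "i * r + c"])
      show "i * r + c < n * r" "j * r + c < n * r" using mult_add_less i j c by auto
      show "(v (i * r + c) \<longlongrightarrow> 0) at_top" using step.IH i bw(1) c by blast
      show "stiffness (i * r + c) (j * r + c) \<noteq> 0" using stiff_adj i j c ij w(3) by auto
      fix a assume a: "a < n * r" "a \<noteq> j * r + c" "stiffness (i * r + c) a \<noteq> 0"
      define i' d where "i' = a div r" and "d = a mod r"
      have id: "i' < n" "d < r" "a = i' * r + d"
        using a(1) c by (auto simp: i'_def d_def less_mult_imp_div_less)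
      show "(v a \<longlongrightarrow> 0) at_top"
      \<comment> \<open>A nonzero entry in the row belongs either to the forcing node itself, which
        is black, or to the same component of a neighbour, and all neighbours but \<open>w\<close>
        are black.\<close>
      proof (cases "i' = i")
        case True
        then show ?thesis using step.IH i bw(1) id by auto
      next
        case False
        then have "c = d" "{b, vs ! i'} \<in> E"
          using stiff_nonadj[of i c i' d] a(3) id i c by auto
        moreover have "vs ! i' \<in> V" using id(1) dvs(2) unfolding n_def by auto
        moreover have "vs ! i' \<noteq> w"
          using a(2) id j dvs(1) \<open>c = d\<close> unfolding n_def by (metis nth_eq_iff_index_eq)
        ultimately have "vs ! i' \<in> S" using bw(2) by blast
        then show ?thesis using step.IH id by auto
      qed
    qed
    note vw = this
    show ?case
    proof (intro allI impI)
      fix k c assume k: "k < n" "vs ! k \<in> S'" and c: "c < r"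
      show "(v (k * r + c) \<longlongrightarrow> 0) at_top"
      proof (cases "k = j")
        case False
        then have "vs ! k \<noteq> w" using k(1) j dvs(1) nth_eq_iff_index_eq unfolding n_def by blast
        then show ?thesis using step.IH k c bw(3) by blast
      qed (use vw c in simp)
    qed
  qed
  have "finite V" using graph(1) by (simp add: simple_graph_def)
  from theI'[OF zf_final_ex1[OF this graph(3)]]
  have "zf_final V Vd E (zf_set V Vd E)" unfolding zf_set_def .
  then have "(zf_step V E)\<^sup>*\<^sup>* Vd V" using zf by (simp add: zero_forcing_def zf_final_def)
  from spread[OF this] have v0: "(v (i * r + c) \<longlongrightarrow> 0) at_top" if "i < n" "c < r" for i c
    using that dvs(2) unfolding n_def by auto
  have p0: "((\<lambda>t. p t $ a) \<longlongrightarrow> 0) at_top" if "a < n * r" for a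
  proof -
    have "a div r < n" "a mod r < r" using that by (cases r; simp add: less_mult_imp_div_less)+
    from v0[OF this] have "(v a \<longlongrightarrow> 0) at_top" by simp
    from p_tendsto[OF this that] show ?thesis .
  qed

  have q0: "((\<lambda>t. q t $ (k * r + c)) \<longlongrightarrow> 0) at_top" if k: "k < m" and c: "c < r" for k c
  proof -
    obtain i j where ij: "i < n" "j < n" "i \<noteq> j" "es ! k = {vs ! i, vs ! j}"
      "\<And>x. x < n \<Longrightarrow> B $$ (x, k) = (if x = i then 1 else if x = j then -1 else 0)"
      "\<And>f :: nat \<Rightarrow> real. (\<Sum>x<n. B $$ (x, k) * f x) = f i - f j"
      by (rule incidence_column[OF inc k[unfolded m_def], folded n_def], rule that)
    \<comment> \<open>\<open>f\<close> is the indicator of the side of \<open>vs ! i\<close> after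
      edge \<open>k\<close> is removed. Edge \<open>k\<close> leaves that side and any other edge
      has both ends on one side, so \<open>B^T f\<close> is the unit vector at \<open>k\<close>, and
      pairing \<open>f\<close> with the net forces isolates the force in edge
      \<open>k\<close>.\<close>
    define reach where "reach x = (\<lambda>x y. {x, y} \<in> E - {es ! k})\<^sup>*\<^sup>* (vs ! i) (vs ! x)" for x
    define f where "f x = (if reach x then 1 else 0 :: real)" for x
    have "es ! k \<in> E" using k des unfolding m_def by auto
    moreover have "vs ! i \<noteq> vs ! j" using ij(1-3) dvs(1) nth_eq_iff_index_eq unfolding n_def by blast
    ultimately have "\<not> reach j"
      using acyclic_edge_is_bridge[OF graph(2)] ij(4) unfolding reach_def by auto
    then have fk: "(\<Sum>x<n. B $$ (x, k) * f x) = 1"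
      unfolding ij(6) by (simp add: f_def reach_def)
    have fl: "(\<Sum>x<n. B $$ (x, l) * f x) = 0" if l: "l < m" "l \<noteq> k" for l
    proof -
      obtain x y where xy: "x < n" "y < n" "x \<noteq> y" "es ! l = {vs ! x, vs ! y}"
        "\<And>z. z < n \<Longrightarrow> B $$ (z, l) = (if z = x then 1 else if z = y then -1 else 0)"
        "\<And>f :: nat \<Rightarrow> real. (\<Sum>z<n. B $$ (z, l) * f z) = f x - f y"
        by (rule incidence_column[OF inc l(1)[unfolded m_def], folded n_def], rule that)
      have "es ! l \<in> E - {es ! k}" using k l des nth_eq_iff_index_eq unfolding m_def by auto
      then have "{vs ! x, vs ! y} \<in> E - {es ! k}" "{vs ! y, vs ! x} \<in> E - {es ! k}"
        using xy(4) by (simp_all add: insert_commute)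
      then have "reach x \<longleftrightarrow> reach y"
        unfolding reach_def
        using rtranclp.rtrancl_into_rtrancl[of "\<lambda>x y. {x, y} \<in> E - {es ! k}" "vs ! i"] by blast
      then show ?thesis unfolding xy(6) by (simp add: f_def)
    qed
    let ?w = "W $$ (k * r + c, k * r + c)"
    have "(\<Sum>x<n. f x * flow (x * r + c) t) = ?w * q t $ (k * r + c)" for t
    proof -
      have "(\<Sum>x<n. f x * flow (x * r + c) t) =
        (\<Sum>x<n. \<Sum>l<m. (B $$ (x, l) * f x) * (W $$ (l * r + c, l * r + c) * q t $ (l * r + c)))"
      proof (rule sum.cong[OF refl])
        fix x assume "x \<in> {..<n}"
        then have "flow (x * r + c) t = (\<Sum>l<m. B $$ (x, l) * (W $$ (l * r + c, l * r + c) * q t $ (l * r + c)))"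
          unfolding flow_def mult.assoc by (simp only: G_sum c lessThan_iff)
        then show "f x * flow (x * r + c) t =
          (\<Sum>l<m. (B $$ (x, l) * f x) * (W $$ (l * r + c, l * r + c) * q t $ (l * r + c)))"
          by (simp add: sum_distrib_left mult_ac)
      qed
      also have "\<dots> = (\<Sum>l<m. (\<Sum>x<n. B $$ (x, l) * f x) * (W $$ (l * r + c, l * r + c) * q t $ (l * r + c)))"
        by (subst sum.swap) (simp add: sum_distrib_right)
      also have "\<dots> = (\<Sum>l<m. if l = k then ?w * q t $ (k * r + c) else 0)"
        by (intro sum.cong refl) (auto simp: fk fl)
      finally show ?thesis using k by simp
    qed
    moreover have "((\<lambda>t. \<Sum>x<n. f x * flow (x * r + c) t) \<longlongrightarrow> 0) at_top"
      by (intro tendsto_null_sum tendsto_mult_right_zero flow_tendsto mult_add_less v0) (use c in auto)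
    ultimately have "((\<lambda>t. ?w * q t $ (k * r + c)) \<longlongrightarrow> 0) at_top" by presburger
    from tendsto_mult_left[OF this, of "1 / ?w"] F(6)[rule_format, OF mult_add_less[OF k c]]
    show ?thesis by simp
  qed
  have q0': "((\<lambda>t. q t $ l) \<longlongrightarrow> 0) at_top" if "l < m * r" for l
  proof -
    have "l div r < m" "l mod r < r" using that by (cases r; simp add: less_mult_imp_div_less)+
    from q0[OF this] show ?thesis by (simp add: div_mult_mod_eq)
  qed
  have "((\<lambda>t. sqrt ((\<Sum>a<n * r. (p t $ a)\<^sup>2) + (\<Sum>l<m * r. (q t $ l)\<^sup>2))) \<longlongrightarrow>
      sqrt ((\<Sum>a<n * r. 0\<^sup>2) + (\<Sum>l<m * r. 0\<^sup>2))) at_top"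
    by (intro tendsto_real_sqrt tendsto_add tendsto_sum tendsto_power p0 q0') auto
  \<comment> \<open>The states are known to have the right dimensions for nonnegative times only, so
    the two functions agree eventually.\<close>
  moreover have "\<forall>\<^sub>F t in at_top. sqrt ((\<Sum>a<n * r. (p t $ a)\<^sup>2) + (\<Sum>l<m * r. (q t $ l)\<^sup>2)) =
      state_norm (p t) (q t)"
    unfolding eventually_at_top_linorder using dis(2) state_norm_eq by (metis (no_types))
  ultimately show ?thesis by (simp add: filterlim_cong[OF refl refl])
qed

text \<open>The order of quantifiers is the point: one constant serves all solutions, which gives
  Lyapunov stability.\<close>

lemma feasible_stable:
  assumes B: "B \<in> carrier_mat (length vs) (length es)"
    and feas: "feasible r vs es Vd M W R"
  shows "\<exists>C. \<forall>p q. solution (kronecker B (1\<^sub>m r)) M W R p q \<longrightarrow>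
    (\<forall>t\<ge>0. state_norm (p t) (q t) \<le> sqrt C * state_norm (p 0) (q 0))"
proof -
  define n where "n = length vs * r"
  define m where "m = length es * r"
  show ?thesis
  \<comment> \<open>The witness for \<open>C\<close> stays open here and is fixed by the last
    inequality, whose constant involves only \<open>M\<close> and \<open>W\<close>.\<close>
  proof (intro exI allI impI)
    fix p q and t :: real
    assume sol: "solution (kronecker B (1\<^sub>m r)) M W R p q" and t: "t \<ge> 0"
    note dis = solution_dissipative[OF B feas sol, folded n_def m_def]
    have "state_norm (p t) (q t) = sqrt ((\<Sum>a<n. (p t $ a)\<^sup>2) + (\<Sum>l<m. (q t $ l)\<^sup>2))"
      using state_norm_eq dis(2)[OF t] by blast
    also have "\<dots> \<le> sqrt (((\<Sum>a<n. M $$ (a, a)) + (\<Sum>l<m. 1 / W $$ (l, l))) *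
        ((\<Sum>a<n. 1 / M $$ (a, a)) + (\<Sum>l<m. W $$ (l, l))) *
        ((\<Sum>a<n. (p 0 $ a)\<^sup>2) + (\<Sum>l<m. (q 0 $ l)\<^sup>2)))"
      by (intro real_sqrt_le_mono dissipative_system.state_bound[OF dis(1) t])
    also have "\<dots> = sqrt (((\<Sum>a<n. M $$ (a, a)) + (\<Sum>l<m. 1 / W $$ (l, l))) *
        ((\<Sum>a<n. 1 / M $$ (a, a)) + (\<Sum>l<m. W $$ (l, l)))) * state_norm (p 0) (q 0)"
      using state_norm_eq[of "p 0" n "q 0" m] dis(2)[of 0] by (simp add: real_sqrt_mult)
    finally show "state_norm (p t) (q t) \<le> \<dots>" .
  qed
qed

lemma zero_forcing_imp_PI_GAS:
  assumes "oriented_incidence vs es B" "numbering vs V" "numbering es E"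
    "simple_graph V E" "\<nexists>xs. is_cycle E xs" "Vd \<subseteq> V" "zero_forcing V Vd E"
  shows "PI_GAS r vs es Vd B"
  unfolding PI_GAS_def origin_GAS_def
proof (intro allI impI conjI)
  fix M W R and \<epsilon> :: real
  assume feas: "feasible r vs es Vd M W R" and eps: "\<epsilon> > 0"
  have "B \<in> carrier_mat (length vs) (length es)" using assms(1) by (simp add: oriented_incidence_def)
  from feasible_stable[OF this feas] obtain C where
    C: "\<And>p q t. solution (kronecker B (1\<^sub>m r)) M W R p q \<Longrightarrow> t \<ge> 0 \<Longrightarrow>
      state_norm (p t) (q t) \<le> sqrt C * state_norm (p 0) (q 0)" by blast
  \<comment> \<open>A positive majorant of \<open>sqrt C\<close>, so that
    \<open>\<epsilon> / D\<close> is a legitimate radius.\<close>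
  define D where "D = \<bar>sqrt C\<bar> + 1"
  have D: "D > 0" "sqrt C \<le> D" by (auto simp: D_def)
  show "\<exists>\<delta>>0. \<forall>p q. solution (kronecker B (1\<^sub>m r)) M W R p q \<and>
      in_Omega (kronecker B (1\<^sub>m r)) (p 0) (q 0) \<and> state_norm (p 0) (q 0) < \<delta> \<longrightarrow>
      (\<forall>t\<ge>0. state_norm (p t) (q t) < \<epsilon>)"
  proof (intro exI[of _ "\<epsilon> / D"] conjI allI impI)
    fix p q and t :: real
    assume *: "solution (kronecker B (1\<^sub>m r)) M W R p q \<and>
      in_Omega (kronecker B (1\<^sub>m r)) (p 0) (q 0) \<and> state_norm (p 0) (q 0) < \<epsilon> / D" and t: "t \<ge> 0"
    have "state_norm (p 0) (q 0) \<ge> 0"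
      unfolding state_norm_def by (auto simp: scalar_prod_def intro!: add_nonneg_nonneg sum_nonneg)
    then have "state_norm (p t) (q t) \<le> D * state_norm (p 0) (q 0)"
      using C[of p q t] * t D(2) by (meson mult_right_mono order_trans)
    also have "\<dots> < \<epsilon>" using * D(1) by (simp add: field_simps)
    finally show "state_norm (p t) (q t) < \<epsilon>" .
  qed (use eps D in auto)
next
  fix M W R p q
  assume "feasible r vs es Vd M W R" "solution (kronecker B (1\<^sub>m r)) M W R p q \<and>
    in_Omega (kronecker B (1\<^sub>m r)) (p 0) (q 0)"
  then show "((\<lambda>t. state_norm (p t) (q t)) \<longlongrightarrow> 0) at_top"
    using zero_forcing_imp_convergence[OF assms] by blast
qed

section \<open>An undamped oscillation\<close>

lemma pos_def_smult_one: "c > 0 \<Longrightarrow> pos_def r (c \<cdot>\<^sub>m 1\<^sub>m r)"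
  unfolding pos_def_def
proof (intro conjI ballI impI)
  fix x :: "real vec" assume c: "c > 0" and x: "x \<in> carrier_vec r" "x \<noteq> 0\<^sub>v r"
  then obtain i where i: "i < r" "x $ i \<noteq> 0" by (metis carrier_vecD eq_vecI index_zero_vec)
  have "(c \<cdot>\<^sub>m 1\<^sub>m r) *\<^sub>v x = c \<cdot>\<^sub>v x"
  proof (rule eq_vecI)
    fix i assume "i < dim_vec (c \<cdot>\<^sub>v x)"
    then have i: "i < r" using x(1) by simp
    have "((c \<cdot>\<^sub>m 1\<^sub>m r) *\<^sub>v x) $ i = (\<Sum>k<r. (c \<cdot>\<^sub>m 1\<^sub>m r) $$ (i, k) * x $ k)"
      using x(1) i by (intro mult_mat_vec_index) auto
    also have "\<dots> = (\<Sum>k<r. if k = i then c * x $ i else 0)"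
      using i by (intro sum.cong) auto
    finally show "((c \<cdot>\<^sub>m 1\<^sub>m r) *\<^sub>v x) $ i = (c \<cdot>\<^sub>v x) $ i" using i x(1) by simp
  qed (use x(1) in auto)
  then have "x \<bullet> ((c \<cdot>\<^sub>m 1\<^sub>m r) *\<^sub>v x) = c * (x \<bullet> x)"
    using x(1) by simp
  moreover have "x \<bullet> x > 0"
    unfolding scalar_prod_sum[OF x(1)] using i by (intro sum_pos2[of _ i]) (auto simp: zero_less_mult_iff linorder_neq_iff)
  ultimately show "x \<bullet> ((c \<cdot>\<^sub>m 1\<^sub>m r) *\<^sub>v x) > 0" using c by simp
qed (auto simp: one_mat_def smult_mat_def intro!: eq_matI)

lemma pos_semidef_zero: "pos_semidef r (0\<^sub>m r r)"
  unfolding pos_semidef_def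
proof (intro conjI ballI)
  fix x :: "real vec" assume "x \<in> carrier_vec r"
  moreover from this have "0\<^sub>m r r *\<^sub>v x = 0\<^sub>v r" by (intro eq_vecI) auto
  ultimately show "0 \<le> x \<bullet> (0\<^sub>m r r *\<^sub>v x)" by simp
qed (auto intro!: eq_matI)

text \<open>For \<open>r = 0\<close> the zero matrix is the identity; for \<open>r \<ge> 1\<close>
  the two differ in the entry at \<open>(0, 0)\<close>.\<close>

lemma not_invertible_zero_mat:
  assumes "r \<ge> 1"
  shows "\<not> invertible_mat (0\<^sub>m r r :: real mat)"
proof
  assume "invertible_mat (0\<^sub>m r r :: real mat)"
  then obtain X :: "real mat" where X: "0\<^sub>m r r * X = 1\<^sub>m r" "X * 0\<^sub>m r r = 1\<^sub>m (dim_row X)"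
    unfolding invertible_mat_def inverts_mat_def by auto
  have "dim_col X = r" "dim_row X = r"
    using arg_cong[OF X(1), of dim_col] arg_cong[OF X(2), of dim_col] by simp_all
  then have "0\<^sub>m r r * X = 0\<^sub>m r r" by (intro left_mult_zero_mat) auto
  then have "(1\<^sub>m r :: real mat) $$ (0, 0) = 0\<^sub>m r r $$ (0, 0)" using X(1) by simp
  then show False using assms by simp
qed

text \<open>At a white node the eigenvector equation serves as the definition of the mass, and only
  positivity must be checked. At a black node its right-hand side is 0, so it asks the positive and
  negative white neighbours to balance; the edge weights arrange this.\<close>

lemma stuck_tree_weights:
  assumes graph: "simple_graph V E" "connected_graph V E" "\<nexists>xs. is_cycle E xs"
    and D: "D \<subseteq> V" "D \<noteq> {}" and stuck: "\<nexists>D'. zf_step V E D D'"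
  obtains \<sigma> mass :: "'a \<Rightarrow> real" and wt :: "'a set \<Rightarrow> real" where
    "\<And>v. v \<in> D \<Longrightarrow> \<sigma> v = 0" "\<And>v. v \<notin> D \<Longrightarrow> \<sigma> v \<noteq> 0"
    "\<And>v. v \<in> V \<Longrightarrow> mass v > 0" "\<And>e. e \<in> E \<Longrightarrow> wt e > 0"
    "\<And>v. v \<in> V \<Longrightarrow> (\<Sum>u | u \<in> V \<and> {v, u} \<in> E. wt {v, u} * (\<sigma> v - \<sigma> u)) = mass v * \<sigma> v"
proof -
  have fin: "finite V" using graph(1) by (simp add: simple_graph_def)
  have VE: "u \<in> V" "v \<in> V" if "{u, v} \<in> E" for u v
    using graph(1) that unfolding simple_graph_def by blast+
  obtain \<sigma> :: "'a \<Rightarrow> real" where \<sigma>: "\<forall>v\<in>D. \<sigma> v = 0" "\<forall>v. v \<notin> D \<longrightarrow> \<sigma> v = 1 \<or> \<sigma> v = -1"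
    "\<forall>u v. {u, v} \<in> E \<and> u \<notin> D \<and> v \<notin> D \<longrightarrow> \<sigma> u * \<sigma> v = -1"
    "\<forall>b\<in>D. \<forall>w. w \<notin> D \<and> {b, w} \<in> E \<longrightarrow> (\<exists>u. {b, u} \<in> E \<and> \<sigma> u = - \<sigma> w)"
    using stuck_tree_signs[OF graph(1,3) stuck] by (elim exE conjE)
  define N where "N b s = {u \<in> V. {b, u} \<in> E \<and> \<sigma> u = s}" for b s
  have finN: "finite (N b s)" for b s using fin by (simp add: N_def)
  \<comment> \<open>An edge between a black and a white node has a unique black end, so one value is
    prescribed. It shares a total weight of 1 equally among the neighbours of equal sign. All other
    edges are only required to have positive weight.\<close>
  have "\<forall>e\<in>E. \<exists>x>0. \<forall>b u. e = {b, u} \<and> b \<in> D \<and> u \<notin> D \<longrightarrow> x = 1 / real (card (N b (\<sigma> u)))"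
  proof
    fix e assume e: "e \<in> E"
    show "\<exists>x>0. \<forall>b u. e = {b, u} \<and> b \<in> D \<and> u \<notin> D \<longrightarrow> x = 1 / real (card (N b (\<sigma> u)))"
    proof (cases "\<exists>b u. e = {b, u} \<and> b \<in> D \<and> u \<notin> D")
      case True
      then obtain b u where bu: "e = {b, u}" "b \<in> D" "u \<notin> D" by blast
      then have "u \<in> N b (\<sigma> u)" using e VE by (auto simp: N_def)
      then have "card (N b (\<sigma> u)) > 0" using finN card_gt_0_iff by blast
      then show ?thesis
        using bu by (intro exI[of _ "1 / real (card (N b (\<sigma> u)))"]) (auto simp: doubleton_eq_iff)
    next
      case False
      then show ?thesis by (intro exI[of _ 1]) auto
    qed
  qed
  then obtain wt where wt: "\<forall>e\<in>E. wt e > 0 \<and>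
      (\<forall>b u. e = {b, u} \<and> b \<in> D \<and> u \<notin> D \<longrightarrow> wt e = 1 / real (card (N b (\<sigma> u))))"
    by metis
  \<comment> \<open>At a white node \<open>\<sigma> v * \<sigma> v = 1\<close> gives \<open>\<sigma>
    v - \<sigma> u = (1 - \<sigma> v * \<sigma> u) * \<sigma> v\<close>, whence this sum. At a black
    node both sides vanish with \<open>\<sigma> v\<close>, so any positive mass will do.\<close>
  define mass where "mass v = (if v \<in> D then 1
    else \<Sum>u | u \<in> V \<and> {v, u} \<in> E. wt {v, u} * (1 - \<sigma> v * \<sigma> u))" for v
  have "mass v > 0" if v: "v \<in> V" for v
  proof (cases "v \<in> D")
    case False
    obtain d where d: "d \<in> D" using D(2) by blast
    then have "(\<lambda>x y. {x, y} \<in> E)\<^sup>*\<^sup>* v d" "v \<noteq> d"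
      using graph(2) v D(1) False unfolding connected_graph_def by auto
    \<comment> \<open>The sum must not be empty: a path from \<open>v\<close> to a black node
      supplies a neighbour.\<close>
    then obtain u0 where u0: "{v, u0} \<in> E" by (meson converse_rtranclpE)
    have term_pos: "wt {v, u} * (1 - \<sigma> v * \<sigma> u) > 0" if "{v, u} \<in> E" for u
    proof -
      have "\<sigma> v * \<sigma> u \<le> 0" using \<sigma>(1,3) that False by (cases "u \<in> D") auto
      then show ?thesis using wt that by simp
    qed
    have "(\<Sum>u | u \<in> V \<and> {v, u} \<in> E. wt {v, u} * (1 - \<sigma> v * \<sigma> u)) > 0"
      using fin u0 VE[OF u0] term_pos by (intro sum_pos) auto
    with False show ?thesis by (simp add: mass_def)
  qed (simp add: mass_def)
  moreover have "(\<Sum>u | u \<in> V \<and> {v, u} \<in> E. wt {v, u} * (\<sigma> v - \<sigma> u)) = mass v * \<sigma> v"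
    if v: "v \<in> V" for v
  proof (cases "v \<in> D")
    case False
    then have "\<sigma> v * \<sigma> v = 1" using \<sigma>(2) by auto
    then have "\<sigma> v - \<sigma> u = (1 - \<sigma> v * \<sigma> u) * \<sigma> v" for u
      by (simp add: algebra_simps)
    then show ?thesis using False by (simp add: mass_def sum_distrib_left mult_ac)
  next
    case True
    have split: "{u. u \<in> V \<and> {v, u} \<in> E} = {u. u \<in> V \<and> {v, u} \<in> E \<and> u \<in> D} \<union> (N v 1 \<union> N v (-1))"
      using \<sigma>(1,2) by (auto simp: N_def)
    have N: "(\<Sum>u\<in>N v s. wt {v, u} * \<sigma> u) = (if N v s = {} then 0 else s)" if "s \<noteq> 0" for s
    proof -
      have "wt {v, u} * \<sigma> u = s / real (card (N v s))" if "u \<in> N v s" for u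
      proof -
        have "{v, u} \<in> E" "u \<notin> D" "\<sigma> u = s" using that \<sigma>(1) \<open>s \<noteq> 0\<close> by (auto simp: N_def)
        then show ?thesis using wt True by auto
      qed
      then have "(\<Sum>u\<in>N v s. wt {v, u} * \<sigma> u) = real (card (N v s)) * (s / real (card (N v s)))"
        by simp
      then show ?thesis using finN[of v s] by (simp add: card_eq_0_iff)
    qed
    \<comment> \<open>The sign condition makes both classes nonempty or both empty; in either case
      the totals \<open>1\<close> and \<open>-1\<close>, or \<open>0\<close> and \<open>0\<close>,
      cancel.\<close>
    have both: "N v 1 = {} \<longleftrightarrow> N v (-1) = {}"
    proof -
      have "N v (- s) \<noteq> {}" if "u \<in> N v s" "s \<noteq> 0" for u s
      proof -
        have u: "{v, u} \<in> E" "u \<notin> D" "\<sigma> u = s" using that \<sigma>(1) by (auto simp: N_def)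
        then obtain u' where "{v, u'} \<in> E" "\<sigma> u' = - \<sigma> u" using \<sigma>(4) True by blast
        then show ?thesis using u(3) VE by (auto simp: N_def)
      qed
      from this[where s = 1] this[where s = "-1"] show ?thesis by force
    qed
    have "(\<Sum>u | u \<in> V \<and> {v, u} \<in> E. wt {v, u} * \<sigma> u) =
      (\<Sum>u | u \<in> V \<and> {v, u} \<in> E \<and> u \<in> D. wt {v, u} * \<sigma> u) + (\<Sum>u\<in>N v 1 \<union> N v (-1). wt {v, u} * \<sigma> u)"
      unfolding split using fin finN \<sigma>(1) by (intro sum.union_disjoint) (auto simp: N_def)
    also have "(\<Sum>u\<in>N v 1 \<union> N v (-1). wt {v, u} * \<sigma> u) =
      (\<Sum>u\<in>N v 1. wt {v, u} * \<sigma> u) + (\<Sum>u\<in>N v (-1). wt {v, u} * \<sigma> u)"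
      using finN by (intro sum.union_disjoint) (auto simp: N_def)
    also have "\<dots> = 0" using both by (simp add: N)
    also have "(\<Sum>u | u \<in> V \<and> {v, u} \<in> E \<and> u \<in> D. wt {v, u} * \<sigma> u) = 0"
      using \<sigma>(1) by (intro sum.neutral) auto
    finally show ?thesis using True \<sigma>(1) by (simp add: sum_negf)
  qed
  moreover have "\<sigma> v \<noteq> 0" if "v \<notin> D" for v using \<sigma>(2) that by fastforce
  ultimately show ?thesis using that[of \<sigma> mass wt] \<sigma>(1) wt by blast
qed

text \<open>The orientation cancels because each column enters twice. What remains is to regroup a
  sum over numbered edges as a sum over the neighbours of one node.\<close>

lemma incidence_laplacian:
  fixes \<sigma> :: "'a \<Rightarrow> real" and wt :: "'a set \<Rightarrow> real"
  assumes inc: "oriented_incidence vs es B" and vs: "numbering vs V" and es: "numbering es E"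
    and i: "i < length vs" and fin: "finite V"
  shows "(\<Sum>k<length es. B $$ (i, k) * wt (es ! k) * (\<Sum>x<length vs. B $$ (x, k) * \<sigma> (vs ! x))) =
    (\<Sum>u | u \<in> V \<and> {vs ! i, u} \<in> E. wt {vs ! i, u} * (\<sigma> (vs ! i) - \<sigma> u))"
proof -
  have d: "distinct vs" "set vs = V" "distinct es" "set es = E"
    using vs es by (auto simp: numbering_def)
  define v where "v = vs ! i"
  \<comment> \<open>The contribution of edge \<open>e\<close> at \<open>v\<close>, written as a sum
    with at most one term. This form absorbs edges that miss \<open>v\<close> and allows the double
    sum over edges and nodes to be exchanged.\<close>
  define h where "h e = (\<Sum>u | u \<in> V \<and> e = {v, u}. wt e * (\<sigma> v - \<sigma> u))" for e
  have "B $$ (i, k) * wt (es ! k) * (\<Sum>x<length vs. B $$ (x, k) * \<sigma> (vs ! x)) = h (es ! k)"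
    if k: "k < length es" for k
  proof -
    obtain x y where xy: "x < length vs" "y < length vs" "x \<noteq> y" "es ! k = {vs ! x, vs ! y}"
      "\<And>z. z < length vs \<Longrightarrow> B $$ (z, k) = (if z = x then 1 else if z = y then -1 else 0)"
      "\<And>f :: nat \<Rightarrow> real. (\<Sum>z<length vs. B $$ (z, k) * f z) = f x - f y"
      by (rule incidence_column[OF inc k], rule that)
    have eq: "vs ! a = vs ! b \<longleftrightarrow> a = b" if "a < length vs" "b < length vs" for a b
      using d(1) that by (rule nth_eq_iff_index_eq)
    have V: "vs ! x \<in> V" "vs ! y \<in> V" using xy d(2) by auto
    consider "i = x" | "i = y" | "i \<noteq> x" "i \<noteq> y" by blast
    then show ?thesis
    proof cases
      case 1
      then have "{u. u \<in> V \<and> es ! k = {v, u}} = {vs ! y}"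
        using V xy(4) by (auto simp: v_def doubleton_eq_iff)
      then show ?thesis unfolding xy(6) h_def using 1 xy(1) by (simp add: xy(5) v_def)
    next
      case 2
      then have "{u. u \<in> V \<and> es ! k = {v, u}} = {vs ! x}"
        using V xy(4) by (auto simp: v_def doubleton_eq_iff)
      then show ?thesis unfolding xy(6) h_def using 2 xy(2,3) by (simp add: xy(5) v_def algebra_simps)
    next
      case 3
      then have no: "{u. u \<in> V \<and> es ! k = {v, u}} = {}"
        using xy(1,2,4) i eq by (auto simp: v_def doubleton_eq_iff)
      show ?thesis unfolding h_def no using 3 i by (simp add: xy(5))
    qed
  qed
  then have "(\<Sum>k<length es. B $$ (i, k) * wt (es ! k) * (\<Sum>x<length vs. B $$ (x, k) * \<sigma> (vs ! x))) =
    (\<Sum>k<length es. h (es ! k))" by (intro sum.cong) auto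
  also have "\<dots> = (\<Sum>e\<in>E. h e)"
    using sum.reindex_bij_betw[OF bij_betw_nth[OF d(3) refl refl], of h] d(4) by simp
  also have "\<dots> = (\<Sum>u\<in>V. \<Sum>e | e \<in> E \<and> e = {v, u}. wt e * (\<sigma> v - \<sigma> u))"
    unfolding h_def using fin d(4) by (intro sum.swap_restrict) auto
  also have "\<dots> = (\<Sum>u\<in>V. if {v, u} \<in> E then wt {v, u} * (\<sigma> v - \<sigma> u) else 0)"
  proof (rule sum.cong[OF refl])
    fix u
    have "{e. e \<in> E \<and> e = {v, u}} = (if {v, u} \<in> E then {{v, u}} else {})" by auto
    then show "(\<Sum>e | e \<in> E \<and> e = {v, u}. wt e * (\<sigma> v - \<sigma> u)) =
      (if {v, u} \<in> E then wt {v, u} * (\<sigma> v - \<sigma> u) else 0)" by simp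
  qed
  also have "\<dots> = (\<Sum>u | u \<in> V \<and> {v, u} \<in> E. wt {v, u} * (\<sigma> v - \<sigma> u))"
    using fin by (simp add: sum.inter_filter)
  finally show ?thesis by (simp add: v_def)
qed

lemma periodic_tendsto_const:
  fixes f :: "real \<Rightarrow> real"
  assumes "(f \<longlongrightarrow> L) at_top" "\<And>k::nat. f (real k * (2 * pi)) = c"
  shows "L = c"
proof -
  have "filterlim (\<lambda>k. real k * (2 * pi)) at_top sequentially"
    by (intro filterlim_at_top_mult_tendsto_pos[OF tendsto_const _ filterlim_real_sequentially]) auto
  from filterlim_compose[OF assms(1) this] have "(\<lambda>k::nat. c) \<longlonglongrightarrow> L"
    by (simp add: assms(2))
  then show ?thesis by (simp add: LIMSEQ_const_iff)
qed

text \<open>The sign vector vanishes on \<open>D\<close> and thus on the damped nodes, so the motion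
  along it is frictionless and periodic and cannot decay.\<close>

lemma stuck_imp_not_PI_GAS:
  assumes inc: "oriented_incidence vs es B" and vs: "numbering vs V" and es: "numbering es E"
    and graph: "simple_graph V E" "connected_graph V E" "\<nexists>xs. is_cycle E xs"
    and D: "D \<subseteq> V" "D \<noteq> V" "Vd \<subseteq> D" "Vd \<noteq> {}" and stuck: "\<nexists>D'. zf_step V E D D'"
    and r: "r \<ge> 1"
  shows "\<not> PI_GAS r vs es Vd B"
proof
  assume GAS: "PI_GAS r vs es Vd B"
  define n where "n = length vs"
  define m where "m = length es"
  have B: "B \<in> carrier_mat n m" using inc by (simp add: oriented_incidence_def n_def m_def)
  have d: "distinct vs" "set vs = V" "distinct es" "set es = E"
    using vs es by (auto simp: numbering_def)
  have fin: "finite V" using graph(1) by (simp add: simple_graph_def)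
  have "D \<noteq> {}" using D(3,4) by blast
  obtain \<sigma> mass wt where w: "\<And>v. v \<in> D \<Longrightarrow> \<sigma> v = (0 :: real)" "\<And>v. v \<notin> D \<Longrightarrow> \<sigma> v \<noteq> 0"
    "\<And>v. v \<in> V \<Longrightarrow> mass v > (0 :: real)" "\<And>e. e \<in> E \<Longrightarrow> wt e > (0 :: real)"
    "\<And>v. v \<in> V \<Longrightarrow> (\<Sum>u | u \<in> V \<and> {v, u} \<in> E. wt {v, u} * (\<sigma> v - \<sigma> u)) = mass v * \<sigma> v"
    by (rule stuck_tree_weights[OF graph D(1) \<open>D \<noteq> {}\<close> stuck], rule that)
  define Ms where "Ms = map (\<lambda>v. mass v \<cdot>\<^sub>m (1\<^sub>m r :: real mat)) vs"
  define Ws where "Ws = map (\<lambda>e. wt e \<cdot>\<^sub>m (1\<^sub>m r :: real mat)) es"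
  \<comment> \<open>The zero block is semidefinite and, since \<open>r \<ge> 1\<close>, singular;
    the damped blocks act only where the sign vector is 0.\<close>
  define Rs where "Rs = map (\<lambda>v. if v \<in> Vd then 1 \<cdot>\<^sub>m (1\<^sub>m r :: real mat) else 0\<^sub>m r r) vs"
  define M where "M = diag_block_mat Ms"
  define W where "W = diag_block_mat Ws"
  define R where "R = diag_block_mat Rs"
  define G where "G = kronecker B (1\<^sub>m r)"
  have Ms: "length Ms = n" "\<forall>i<n. diagonal_mat (Ms ! i) \<and> pos_def r (Ms ! i)"
    using w(3) d(2) by (auto simp: Ms_def n_def diagonal_mat_def intro!: pos_def_smult_one)
  have Ws: "length Ws = m" "\<forall>k<m. diagonal_mat (Ws ! k) \<and> pos_def r (Ws ! k)"
    using w(4) d(4) by (auto simp: Ws_def m_def diagonal_mat_def intro!: pos_def_smult_one)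
  have Rs: "length Rs = n" "\<forall>i<n. vs ! i \<in> Vd \<longrightarrow> pos_def r (Rs ! i)"
    "\<forall>i<n. vs ! i \<notin> Vd \<longrightarrow> Rs ! i = 0\<^sub>m r r"
    using pos_def_smult_one[of 1 r] by (auto simp: Rs_def n_def)
  have feas: "feasible r vs es Vd M W R"
    unfolding feasible_def
    using Ms Ws Rs pos_semidef_zero[of r] not_invertible_zero_mat[OF r]
    by (intro exI[of _ Ms] exI[of _ Ws] exI[of _ Rs]) (simp add: M_def W_def R_def n_def m_def)
  have GASd: "origin_GAS G M W R"
    using GAS feas by (simp add: PI_GAS_def G_def)
  have div: "a div r < N" "a mod r < r" if "a < N * r" for a N
    using that by (cases r; simp add: less_mult_imp_div_less)+
  have car: "\<forall>A\<in>set Ms. A \<in> carrier_mat r r" "\<forall>A\<in>set Ws. A \<in> carrier_mat r r"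
    "\<forall>A\<in>set Rs. A \<in> carrier_mat r r"
    by (auto simp: Ms_def Ws_def Rs_def)
  have M: "M \<in> carrier_mat (n * r) (n * r)" "diagonal_mat M" "\<forall>a<n * r. M $$ (a, a) > 0"
    using diag_blocks[OF Ms] by (auto simp: M_def)
  have W: "W \<in> carrier_mat (m * r) (m * r)" "diagonal_mat W"
    using diag_blocks[OF Ws] by (auto simp: W_def)
  have R: "R \<in> carrier_mat (n * r) (n * r)"
    using diag_block_mat_carrier[OF car(3)] Rs(1) by (simp add: R_def)
  have Mi: "M $$ (a, a) = mass (vs ! (a div r))" if "a < n * r" for a
    using diag_block_mat_index[OF car(1), of a a] that Ms(1) div[OF that]
    by (simp add: M_def) (simp add: Ms_def n_def)
  have Wi: "W $$ (l, l) = wt (es ! (l div r))" if "l < m * r" for l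
    using diag_block_mat_index[OF car(2), of l l] that Ws(1) div[OF that]
    by (simp add: W_def) (simp add: Ws_def m_def)
  have Gc: "G \<in> carrier_mat (n * r) (m * r)" unfolding G_def by (rule kronecker_one_carrier[OF B])
  have Gi: "G $$ (a, l) = (if l mod r = a mod r then B $$ (a div r, l div r) else 0)"
    if "a < n * r" "l < m * r" for a l
    unfolding G_def by (rule kronecker_one_index[OF B that])

  \<comment> \<open>The sign vector copied into all \<open>r\<close> components, and its image
    \<open>z\<close> under \<open>G^T\<close>.\<close>
  define y where "y a = \<sigma> (vs ! (a div r))" for a
  define z where "z l = (\<Sum>a<n * r. G $$ (a, l) * y a)" for l
  have Ry: "R $$ (a, b) * y b = 0" if "a < n * r" "b < n * r" for a b
  proof (cases "a div r = b div r \<and> vs ! (b div r) \<notin> Vd")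
    case True
    then show ?thesis
      using diag_block_mat_index[OF car(3), of a b] that Rs div[OF that(1)] div[OF that(2)]
      by (simp add: R_def)
  next
    case False
    moreover have "y b = 0" if "vs ! (b div r) \<in> Vd" using that w(1) D(3) by (auto simp: y_def)
    ultimately show ?thesis
      using diag_block_mat_index[OF car(3), of a b] that Rs(1) by (auto simp: R_def)
  qed
  have zi: "z l = (\<Sum>x<n. B $$ (x, l div r) * \<sigma> (vs ! x))" if "l < m * r" for l
  proof -
    have "z l = (\<Sum>a<n * r. if a mod r = l mod r then B $$ (a div r, l div r) * \<sigma> (vs ! (a div r)) else 0)"
      unfolding z_def by (intro sum.cong) (auto simp: Gi that y_def)
    then show ?thesis using sum_fixed_mod[OF div(2)[OF that]] by simp
  qed
  \<comment> \<open>The eigenvector equation \<open>G W G^T y = M y\<close>, obtained from the graph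
    Laplacian within each component.\<close>
  have eig: "(\<Sum>l<m * r. G $$ (a, l) * W $$ (l, l) * z l) = M $$ (a, a) * y a" if a: "a < n * r" for a
  proof -
    have "(\<Sum>l<m * r. G $$ (a, l) * W $$ (l, l) * z l) = (\<Sum>l<m * r. if l mod r = a mod r
        then B $$ (a div r, l div r) * wt (es ! (l div r)) * (\<Sum>x<n. B $$ (x, l div r) * \<sigma> (vs ! x))
        else 0)"
      by (intro sum.cong) (auto simp: Gi a Wi zi)
    also have "\<dots> = (\<Sum>k<m. B $$ (a div r, k) * wt (es ! k) * (\<Sum>x<n. B $$ (x, k) * \<sigma> (vs ! x)))"
      by (rule sum_fixed_mod[OF div(2)[OF a]])
    also have "\<dots> = mass (vs ! (a div r)) * \<sigma> (vs ! (a div r))"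
      using incidence_laplacian[OF inc vs es _ fin, of "a div r" wt \<sigma>] w(5)[of "vs ! (a div r)"]
        div(1)[OF a] nth_mem[of "a div r" vs] d(2) unfolding n_def m_def by simp
    finally show ?thesis by (simp add: Mi a y_def)
  qed

  \<comment> \<open>With velocity \<open>cos t * y\<close> the edges are displaced by
    \<open>sin t * z\<close>; eigenvalue 1 makes the frequency 1. At time 0 there is no
    displacement, so the start lies in the invariant subspace.\<close>
  define p where "p t = vec (n * r) (\<lambda>a. cos t * (M $$ (a, a) * y a))" for t
  define q where "q t = vec (m * r) (\<lambda>l. sin t * z l)" for t
  have "solution G M W R p q"
    unfolding solution_iff_components[OF Gc M W R]
  proof (intro conjI allI impI)
    fix a assume a: "a < n * r"
    have "(\<Sum>b<n * r. R $$ (a, b) * (p t $ b / M $$ (b, b))) = 0" for t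
    proof (rule sum.neutral, rule ballI)
      fix b assume "b \<in> {..<n * r}"
      moreover from this have "M $$ (b, b) \<noteq> 0" using M(3) by force
      ultimately have "R $$ (a, b) * (p t $ b / M $$ (b, b)) = cos t * (R $$ (a, b) * y b)"
        by (simp add: p_def)
      then show "R $$ (a, b) * (p t $ b / M $$ (b, b)) = 0"
        using Ry a \<open>b \<in> {..<n * r}\<close> by simp
    qed
    moreover have "(\<Sum>l<m * r. G $$ (a, l) * W $$ (l, l) * q t $ l) = sin t * (M $$ (a, a) * y a)" for t
      unfolding eig[OF a, symmetric] by (simp add: q_def sum_distrib_left mult_ac)
    moreover have "deriv_on_pos (\<lambda>t. p t $ a) (\<lambda>t. - sin t * (M $$ (a, a) * y a))"
      using a unfolding deriv_on_pos_def p_def by (auto intro!: derivative_eq_intros)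
    ultimately show "deriv_on_pos (\<lambda>t. p t $ a) (\<lambda>t. - (\<Sum>b<n * r. R $$ (a, b) * (p t $ b / M $$ (b, b))) -
        (\<Sum>l<m * r. G $$ (a, l) * W $$ (l, l) * q t $ l))" by simp
  next
    fix l assume l: "l < m * r"
    have "(\<Sum>a<n * r. G $$ (a, l) * (p t $ a / M $$ (a, a))) = cos t * z l" for t
    proof -
      have "(\<Sum>a<n * r. G $$ (a, l) * (p t $ a / M $$ (a, a))) = (\<Sum>a<n * r. cos t * (G $$ (a, l) * y a))"
        using M(3) by (intro sum.cong) (auto simp: p_def)
      then show ?thesis by (simp add: z_def sum_distrib_left)
    qed
    moreover have "deriv_on_pos (\<lambda>t. q t $ l) (\<lambda>t. cos t * z l)"
      using l unfolding deriv_on_pos_def q_def by (auto intro!: derivative_eq_intros)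
    ultimately show "deriv_on_pos (\<lambda>t. q t $ l) (\<lambda>t. \<Sum>a<n * r. G $$ (a, l) * (p t $ a / M $$ (a, a)))"
      by simp
  qed (simp_all add: p_def q_def)
  moreover have "in_Omega G (p 0) (q 0)"
  proof -
    have "q 0 = transpose_mat G *\<^sub>v 0\<^sub>v (n * r)" using Gc by (intro eq_vecI) (auto simp: q_def)
    then show ?thesis using Gc unfolding in_Omega_def by (auto simp: p_def)
  qed
  ultimately have lim: "((\<lambda>t. state_norm (p t) (q t)) \<longlongrightarrow> 0) at_top"
    using GASd by (auto simp: origin_GAS_def)
  have "sin (real k * (2 * pi)) = 0" "cos (real k * (2 * pi)) = 1" for k
    using sin_npi[of "2 * k"] cos_2npi[of k] by (simp_all add: mult_ac)
  then have "state_norm (p (real k * (2 * pi))) (q (real k * (2 * pi))) = state_norm (p 0) (q 0)" for k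
    by (simp add: p_def q_def)
  \<comment> \<open>The state returns after every period, so the limit of its norm is the initial
    norm.\<close>
  from periodic_tendsto_const[OF lim this] have zero: "state_norm (p 0) (q 0) = 0" by simp
  obtain x where x: "x \<in> V" "x \<notin> D" using D(1,2) by blast
  then obtain i where i: "i < n" "vs ! i = x" using d(2) unfolding n_def by (metis in_set_conv_nth)
  \<comment> \<open>Component 0 of a white node exists because \<open>r \<ge> 1\<close>; there the
    initial momentum is mass times a nonzero sign.\<close>
  have ir: "i * r < n * r" using i r by simp
  have "p 0 $ (i * r) \<noteq> 0"
    using M(3)[rule_format, OF ir] ir w(2)[OF x(2)] i r by (auto simp: p_def y_def)
  then have "(\<Sum>a<n * r. (p 0 $ a)\<^sup>2) > 0" using ir by (intro sum_pos2[of _ "i * r"]) auto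
  then have "p 0 \<bullet> p 0 > 0"
    using scalar_prod_sum[of "p 0" "n * r" "p 0"] by (simp add: p_def power2_eq_square)
  moreover have "q 0 \<bullet> q 0 \<ge> 0" by (auto simp: scalar_prod_def intro!: sum_nonneg)
  ultimately show False using zero by (simp add: state_norm_def)
qed

theorem proposition5p13:
  fixes V Vd :: "'a set" and E :: "'a set set"
    and r :: nat and vs :: "'a list" and es :: "'a set list" and B :: "real mat"
  assumes "damping_graph V Vd E"
    and "tree_graph V E"
    and "r \<ge> 1"
    and "numbering vs V" and "numbering es E"
    and "oriented_incidence vs es B"
  shows "zero_forcing V Vd E \<longleftrightarrow> PI_GAS r vs es Vd B"
proof
  have g: "simple_graph V E" "connected_graph V E" "\<nexists>xs. is_cycle E xs" "Vd \<noteq> {}" "Vd \<subseteq> V"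
    using assms(1,2) by (simp_all add: damping_graph_def tree_graph_def)
  then have fin: "finite V" by (simp add: simple_graph_def)
  show "PI_GAS r vs es Vd B" if "zero_forcing V Vd E"
    by (rule zero_forcing_imp_PI_GAS[OF assms(6,4,5) g(1,3,5) that])
  show "zero_forcing V Vd E" if gas: "PI_GAS r vs es Vd B"
  proof (rule ccontr)
    define D where "D = zf_set V Vd E"
    assume "\<not> zero_forcing V Vd E"
    then have ne: "D \<noteq> V" by (simp add: zero_forcing_def D_def)
    from theI'[OF zf_final_ex1[OF fin g(5)]]
    have "zf_final V Vd E D" unfolding D_def zf_set_def .
    then have D: "(zf_step V E)\<^sup>*\<^sup>* Vd D" "\<nexists>D'. zf_step V E D D'"
      unfolding zf_final_def by blast+
    show False
      using stuck_imp_not_PI_GAS[OF assms(6,4,5) g(1-3) zf_steps_subset[OF D(1) g(5)] ne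
          zf_steps_mono[OF D(1)] g(4) D(2) assms(3)] gas by blast
  qed
qed

end
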